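(* Let $\gamma > 0$. The data $(U_-,W_-,X)$ are informative for $\mathcal{H}_2$ suboptimal control if and only if at least one of the following two conditions is satisfied: (i) There exists a right inverse $X_-^\dagger$ of $X_-$ such that $X_+ X_-^\dagger$ is stable and $\begin{bmatrix} W_- \\ Z_- \end{bmatrix} X_-^\dagger = 0$. (ii) There exist right inverses $X_-^\dagger$ of $X_-$ and $W_-^\dagger$ of $W_-$ such that $X_+ X_-^\dagger$ is stable, $W_- X_-^\dagger = 0$, $\begin{bmatrix} X_- \\ U_- \end{bmatrix} W_-^\dagger = 0$, and the unique solution $P$ to $$(X_-^\dagger)^\top \left( X_+^\top P X_+ - X_-^\top P X_- + Z_-^\top Z_- \right) X_-^\dagger = 0$$ has the property that $$\operatorname{tr} \left( (X_+W_-^\dagger)^\top P X_+W_-^\dagger \right) < \gamma.$$ Moreover, a matrix $K\in\mathbb{R}^{m\times n}$ is an $\mathcal{H}_2$ suboptimal feedback gain for all $(A,B,E) \in \Sigma_{\mathrm{i/d/s}}$ if and only if $K = U_- X_-^\dagger$, where $X_-^\dagger$ satisfies the conditions of (i) or (ii).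
   Context: All matrices are real; $\operatorname{tr}$ denotes trace. A square matrix is stable if all its eigenvalues lie in the open unit disk. A right inverse of a matrix $M$ is a matrix $M^\dagger$ with $MM^\dagger = I$. Data. There is a fixed system $x(t+1) = A_s x(t) + B_s u(t) + E_s w(t)$, $z(t) = Cx(t)+Du(t)$, with state $x\in\mathbb{R}^n$, input $u\in\mathbb{R}^m$, disturbance $w\in\mathbb{R}^d$, performance output $z\in\mathbb{R}^p$, where $A_s\in\mathbb{R}^{n\times n}$, $B_s\in\mathbb{R}^{n\times m}$, $E_s\in\mathbb{R}^{n\times d}$ are unknown and $C\in\mathbb{R}^{p\times n}$, $D\in\mathbb{R}^{p\times m}$ are known. From it one has measured $U_- = [u(0)\ \cdots\ u(T-1)]$, $W_- = [w(0)\ \cdots\ w(T-1)]$ and $X=[x(0)\ \cdots\ x(T)]$, and one sets $X_- = [x(0)\ \cdots\ x(T-1)]$, $X_+ = [x(1)\ \cdots\ x(T)]$ and $Z_- := CX_-+DU_-$. Thus $X_+ = A_sX_- + B_sU_- + E_sW_-$. The set of systems explaining the data is $$\Sigma_{\mathrm{i/d/s}} = \{(A,B,E)\in\mathbb{R}^{n\times n}\times\mathbb{R}^{n\times m}\times\mathbb{R}^{n\times d} \mid X_+ = AX_- + BU_- + EW_-\}.$$ Cost. For $(A,B,E)$ and $K\in\mathbb{R}^{m\times n}$ let $T_K(t) = (C+DK)(A+BK)^tE$ and $J_{\mathcal{H}_2}(K)=\sum_{t=0}^\infty \operatorname{tr}\left(T_K(t)^\top T_K(t)\right)$. Given $\gamma>0$,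 $K$ is an $\mathcal{H}_2$ suboptimal feedback gain (also called $\mathcal{H}_2$ suboptimal controller) for $(A,B,E)$ if $A+BK$ is stable and $J_{\mathcal{H}_2}(K)<\gamma$. Informativity. The data $(U_-,W_-,X)$ are informative for $\mathcal{H}_2$ suboptimal control (for given $\gamma$) if there exists a single matrix $K$ that is an $\mathcal{H}_2$ suboptimal feedback gain for all $(A,B,E)\in\Sigma_{\mathrm{i/d/s}}$. *)

theory Defs
  imports Complex_Main "Jordan_Normal_Form.Char_Poly"
begin

definition mat_trace :: "'a :: comm_monoid_add mat \<Rightarrow> 'a" where
  "mat_trace M = (\<Sum>i<dim_row M. M $$ (i, i))"

text \<open>Stability refers to all complex eigenvalues of the real matrix.\<close>

definition stable_mat :: "real mat \<Rightarrow> bool" where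
  "stable_mat M \<longleftrightarrow> square_mat M \<and>
     (\<forall>k. eigenvalue (map_mat complex_of_real M) k \<longrightarrow> cmod k < 1)"

definition right_inverse_mat :: "real mat \<Rightarrow> real mat \<Rightarrow> bool" where
  "right_inverse_mat M R \<longleftrightarrow> R \<in> carrier_mat (dim_col M) (dim_row M) \<and> inverts_mat M R"

text \<open>
  For \<open>X = [x(0) ... x(T)]\<close>, the matrices \<open>X_- = [x(0) ... x(T-1)]\<close> and
  \<open>X_+ = [x(1) ... x(T)]\<close>.
\<close>

definition past :: "real mat \<Rightarrow> real mat" where
  "past X = mat (dim_row X) (dim_col X - 1) (\<lambda>(i, t). X $$ (i, t))"

definition future :: "real mat \<Rightarrow> real mat" where
  "future X = mat (dim_row X) (dim_col X - 1) (\<lambda>(i, t). X $$ (i, Suc t))"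

definition output_data :: "real mat \<Rightarrow> real mat \<Rightarrow> real mat \<Rightarrow> real mat \<Rightarrow> real mat" where
  "output_data C D U X = C * past X + D * U"

definition explaining_systems ::
  "real mat \<Rightarrow> real mat \<Rightarrow> real mat \<Rightarrow> (real mat \<times> real mat \<times> real mat) set" where
  "explaining_systems U W X =
     {(A, B, E). A \<in> carrier_mat (dim_row X) (dim_row X) \<and>
                 B \<in> carrier_mat (dim_row X) (dim_row U) \<and>
                 E \<in> carrier_mat (dim_row X) (dim_row W) \<and>
                 future X = A * past X + B * U + E * W}"

definition closed_loop_response ::
  "real mat \<Rightarrow> real mat \<Rightarrow> real mat \<times> real mat \<times> real mat \<Rightarrow> real mat \<Rightarrow> nat \<Rightarrow> real mat" where
  "closed_loop_response C D = (\<lambda>(A, B, E) K t. (C + D * K) * (A + B * K) ^\<^sub>m t * E)"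

definition h2_cost ::
  "real mat \<Rightarrow> real mat \<Rightarrow> real mat \<times> real mat \<times> real mat \<Rightarrow> real mat \<Rightarrow> real" where
  "h2_cost C D S K =
     (\<Sum>t. mat_trace (transpose_mat (closed_loop_response C D S K t)
                      * closed_loop_response C D S K t))"

text \<open>
  The series defining the cost converges whenever \<open>A + B K\<close> is stable, so the default value of
  a divergent sum plays no role here.
\<close>

definition h2_suboptimal ::
  "real mat \<Rightarrow> real mat \<Rightarrow> real \<Rightarrow> real mat \<times> real mat \<times> real mat \<Rightarrow> real mat \<Rightarrow> bool" where
  "h2_suboptimal C D \<gamma> = (\<lambda>(A, B, E) K.
     stable_mat (A + B * K) \<and> h2_cost C D (A, B, E) K < \<gamma>)"

definition h2_informative ::
  "real mat \<Rightarrow> real mat \<Rightarrow> real \<Rightarrow> real mat \<Rightarrow> real mat \<Rightarrow> real mat \<Rightarrow> bool" where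
  "h2_informative C D \<gamma> U W X \<longleftrightarrow>
     (\<exists>K \<in> carrier_mat (dim_row U) (dim_row X).
        \<forall>S \<in> explaining_systems U W X. h2_suboptimal C D \<gamma> S K)"

text \<open>In the following conditions, \<open>R\<close> and \<open>V\<close> are right inverses of \<open>X_-\<close> and \<open>W_-\<close>.\<close>

definition condition_i ::
  "real mat \<Rightarrow> real mat \<Rightarrow> real mat \<Rightarrow> real mat \<Rightarrow> real mat \<Rightarrow> real mat \<Rightarrow> bool" where
  "condition_i C D U W X R \<longleftrightarrow>
     right_inverse_mat (past X) R \<and>
     stable_mat (future X * R) \<and>
     (W @\<^sub>r output_data C D U X) * R = 0\<^sub>m (dim_row W + dim_row C) (dim_row X)"

definition lyapunov_solution ::
  "real mat \<Rightarrow> real mat \<Rightarrow> real mat \<Rightarrow> real mat \<Rightarrow> real mat \<Rightarrow> real mat \<Rightarrow> bool" where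
  "lyapunov_solution C D U X R P \<longleftrightarrow>
     P \<in> carrier_mat (dim_row X) (dim_row X) \<and>
     transpose_mat R *
       (transpose_mat (future X) * P * future X - transpose_mat (past X) * P * past X
        + transpose_mat (output_data C D U X) * output_data C D U X) * R
     = 0\<^sub>m (dim_row X) (dim_row X)"

definition condition_ii ::
  "real mat \<Rightarrow> real mat \<Rightarrow> real \<Rightarrow> real mat \<Rightarrow> real mat \<Rightarrow> real mat \<Rightarrow> real mat \<Rightarrow> bool" where
  "condition_ii C D \<gamma> U W X R \<longleftrightarrow>
     right_inverse_mat (past X) R \<and>
     (\<exists>V. right_inverse_mat W V \<and>
        stable_mat (future X * R) \<and>
        W * R = 0\<^sub>m (dim_row W) (dim_row X) \<and>
        (past X @\<^sub>r U) * V = 0\<^sub>m (dim_row X + dim_row U) (dim_row W) \<and>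
        (\<exists>P. lyapunov_solution C D U X R P \<and>
             (\<forall>Q. lyapunov_solution C D U X R Q \<longrightarrow> Q = P) \<and>
             mat_trace (transpose_mat (future X * V) * P * (future X * V)) < \<gamma>))"

end

theory Submission
  imports Defs "Jordan_Normal_Form.Spectral_Radius"
begin

text \<open>
  If \<open>K\<close> works for every explaining system, then along every line of explaining systems the closed
  loop is stable, hence has bounded trace; as the directions form a left module over the square
  matrices, this forces \<open>A0 + B0 K = 0\<close> for every direction \<open>(A0, B0, E0)\<close>. By the Fredholm alternative
  the columns of \<open>[I; K; 0]\<close> then lie in the column space of \<open>[X_-; U_-; W_-]\<close>, which gives \<open>X_-\<^sup>\<dagger>\<close> with
  \<open>K = U_- X_-\<^sup>\<dagger>\<close> and \<open>W_- X_-\<^sup>\<dagger> = 0\<close>, and the closed loop is \<open>X_+ X_-\<^sup>\<dagger>\<close> for all explaining systems.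
  The first summand of the cost is bounded by \<open>\<gamma>\<close> along these lines as well, so \<open>(C + D K) E0 = 0\<close>.
  Hence either \<open>C + D K = Z_- X_-\<^sup>\<dagger>\<close> vanishes, which is condition (i), or every \<open>E0\<close> vanishes, and a
  second use of the Fredholm alternative yields \<open>W_-\<^sup>\<dagger>\<close> and determines \<open>E = X_+ W_-\<^sup>\<dagger>\<close>. In that case the
  cost telescopes to \<open>tr (E\<^sup>T P E)\<close> with \<open>P\<close> the solution of the Lyapunov equation, which is (ii).
\<close>

section \<open>Matrix preliminaries\<close>

lemma index_mult_mat_sum:
  assumes "A \<in> carrier_mat nr n" "B \<in> carrier_mat n nc" "i < nr" "j < nc"
  shows "(A * B) $$ (i, j) = (\<Sum>k<n. A $$ (i, k) * B $$ (k, j))"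
  using assms by (auto simp: scalar_prod_def lessThan_atLeast0 intro!: sum.cong)

text \<open>The residual of \<open>y\<close> after orthogonal projection onto the span of the
  \<open>v k\<close> is orthogonal to every \<open>v k\<close>. By \<open>ann\<close> it is then
  orthogonal to \<open>y\<close>, hence to itself, so it vanishes on \<open>I\<close>.\<close>

lemma finite_fredholm_alternative:
  fixes v :: "'k \<Rightarrow> 'i \<Rightarrow> real" and y :: "'i \<Rightarrow> real"
  assumes I: "finite I" and K: "finite K"
    and ann: "\<And>a. (\<And>k. k \<in> K \<Longrightarrow> (\<Sum>i\<in>I. a i * v k i) = 0) \<Longrightarrow> (\<Sum>i\<in>I. a i * y i) = 0"
  shows "\<exists>c. \<forall>i\<in>I. y i = (\<Sum>k\<in>K. c k * v k i)"
proof -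
  define ip :: "('i \<Rightarrow> real) \<Rightarrow> ('i \<Rightarrow> real) \<Rightarrow> real" where "ip f g = (\<Sum>i\<in>I. f i * g i)" for f g
  have ip_diff: "ip (\<lambda>i. f i - c * g i) h = ip f h - c * ip g h" for f g h c
    by (simp add: ip_def left_diff_distrib sum_subtractf sum_distrib_left mult.assoc)
  have ip_diff2: "ip h (\<lambda>i. f i - c * g i) = ip h f - c * ip h g" for f g h c
    by (simp add: ip_def right_diff_distrib sum_subtractf sum_distrib_left mult.left_commute)
  have ip_sum: "ip h (\<lambda>i. \<Sum>k\<in>J. c k * v k i) = (\<Sum>k\<in>J. c k * ip h (v k))" for h c J
    by (simp add: ip_def sum_distrib_left sum.swap[of _ J I] mult.left_commute)
  \<comment> \<open>orthogonal projection onto the span of the \<open>v k\<close>, by Gram-Schmidt\<close>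
  have projection: "\<exists>c. \<forall>k\<in>K. ip (\<lambda>i. z i - (\<Sum>k\<in>K. c k * v k i)) (v k) = 0" for z
    using K
  proof (induction K arbitrary: z)
    case (insert l J)
    from insert.IH obtain c where c: "\<forall>k\<in>J. ip (\<lambda>i. z i - (\<Sum>k\<in>J. c k * v k i)) (v k) = 0" by blast
    from insert.IH obtain b where b: "\<forall>k\<in>J. ip (\<lambda>i. v l i - (\<Sum>k\<in>J. b k * v k i)) (v k) = 0" by blast
    define q where "q = (\<lambda>i. z i - (\<Sum>k\<in>J. c k * v k i))"
    define r where "r = (\<lambda>i. v l i - (\<Sum>k\<in>J. b k * v k i))"
    \<comment> \<open>\<open>r\<close> is the part of \<open>v l\<close> orthogonal to the earlier
      vectors. If it vanishes on \<open>I\<close>, the division yields \<open>s = 0\<close>, which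
      is harmless because then \<open>ip q r = 0\<close> as well.\<close>
    define s where "s = ip q r / ip r r"
    define c' where "c' = (\<lambda>k. if k = l then s else c k - s * b k)"
    have eq: "(\<lambda>i. z i - (\<Sum>k\<in>insert l J. c' k * v k i)) = (\<lambda>i. q i - s * r i)"
    proof
      fix i
      have "(\<Sum>k\<in>J. c' k * v k i) = (\<Sum>k\<in>J. c k * v k i - s * (b k * v k i))"
        using insert.hyps by (intro sum.cong) (auto simp: c'_def algebra_simps)
      then show "z i - (\<Sum>k\<in>insert l J. c' k * v k i) = q i - s * r i"
        using insert.hyps
        by (simp add: q_def r_def c'_def sum_subtractf sum_distrib_left algebra_simps)
    qed
    have q0: "ip q (v k) = 0" and r0: "ip r (v k) = 0" if "k \<in> J" for k
      using that b c by (auto simp: q_def r_def)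
    have vl: "v l = (\<lambda>i. r i - (-1) * (\<Sum>k\<in>J. b k * v k i))" by (simp add: r_def)
    have l: "ip h (v l) = ip h r + (\<Sum>k\<in>J. b k * ip h (v k))" for h
      by (subst vl, subst ip_diff2, subst ip_sum) simp
    have "ip q r = 0" if "ip r r = 0"
    proof -
      have "r i = 0" if "i \<in> I" for i
        using \<open>ip r r = 0\<close> I that by (simp add: ip_def sum_nonneg_eq_0_iff)
      then show ?thesis by (simp add: ip_def)
    qed
    then have "ip (\<lambda>i. q i - s * r i) r = 0"
      unfolding ip_diff by (auto simp: s_def)
    then have "\<forall>k\<in>insert l J. ip (\<lambda>i. q i - s * r i) (v k) = 0"
      using q0 r0 by (auto simp: ip_diff l)
    then show ?case unfolding eq[symmetric] by blast
  qed simp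
  then obtain c where c: "\<forall>k\<in>K. ip (\<lambda>i. y i - (\<Sum>k\<in>K. c k * v k i)) (v k) = 0" by blast
  define q where "q = (\<lambda>i. y i - (\<Sum>k\<in>K. c k * v k i))"
  have qv: "ip q (v k) = 0" if "k \<in> K" for k using c that by (simp add: q_def)
  have "ip q y = 0" using ann[of q] qv by (simp add: ip_def)
  moreover have "q = (\<lambda>i. y i - 1 * (\<Sum>k\<in>K. c k * v k i))" by (simp add: q_def)
  then have "ip q q = ip q y - 1 * ip q (\<lambda>i. \<Sum>k\<in>K. c k * v k i)" by (metis ip_diff2)
  ultimately have "ip q q = 0" using qv by (simp add: ip_sum)
  then have "\<forall>i\<in>I. q i = 0" using I by (simp add: ip_def sum_nonneg_eq_0_iff)
  then show ?thesis by (auto simp: q_def)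
qed

section \<open>Traces and powers of stable matrices\<close>

lemma mat_trace_mult_commute:
  fixes A B :: "'a :: comm_semiring_0 mat"
  assumes "A \<in> carrier_mat n m" "B \<in> carrier_mat m n"
  shows "mat_trace (A * B) = mat_trace (B * A)"
proof -
  have "mat_trace (A * B) = (\<Sum>i<n. \<Sum>j<m. A $$ (i, j) * B $$ (j, i))"
    using assms by (auto simp: mat_trace_def scalar_prod_def lessThan_atLeast0 intro!: sum.cong)
  also have "\<dots> = (\<Sum>j<m. \<Sum>i<n. B $$ (j, i) * A $$ (i, j))"
    by (subst sum.swap) (simp add: mult.commute)
  also have "\<dots> = mat_trace (B * A)"
    using assms by (auto simp: mat_trace_def scalar_prod_def lessThan_atLeast0 intro!: sum.cong)
  finally show ?thesis .
qed

text \<open>Over the complex numbers \<open>M\<close> is similar to an upper triangular matrix. Its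
  trace is the sum of the diagonal entries there, and these are eigenvalues, so each has modulus
  below one.\<close>

lemma stable_mat_trace_bound:
  assumes M: "M \<in> carrier_mat n n" and "stable_mat M"
  shows "\<bar>mat_trace M\<bar> \<le> real n"
proof -
  let ?A = "map_mat complex_of_real M"
  have A: "?A \<in> carrier_mat n n" using M by simp
  obtain as where "char_poly ?A = (\<Prod>a\<leftarrow>as. [:- a, 1:])"
    using char_poly_factorized[OF A] by blast
  from schur_decomposition_exists[OF A this] obtain B where
    B: "B \<in> carrier_mat n n" and ut: "upper_triangular B" and sim: "similar_mat ?A B" by blast
  from sim obtain P Q where "similar_mat_wit ?A B P Q" unfolding similar_mat_def by blast
  from similar_mat_witD2[OF A this] have
    PQ: "Q * P = 1\<^sub>m n" "?A = P * B * Q" and car: "P \<in> carrier_mat n n" "Q \<in> carrier_mat n n" by auto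
  have "mat_trace ?A = mat_trace (P * (B * Q))" using PQ car B by simp
  also have "\<dots> = mat_trace (B * Q * P)"
    by (rule mat_trace_mult_commute[of _ n n]) (use car B in auto)
  also have "B * Q * P = B" using PQ car B by simp
  finally have tr: "mat_trace ?A = mat_trace B" .
  have ev: "cmod (B $$ (i, i)) \<le> 1" if "i < n" for i
  proof -
    have "poly (char_poly B) (B $$ (i, i)) = 0"
      unfolding char_poly_upper_triangular[OF B ut] poly_prod_list_zero_iff
      using that B by (auto simp: diag_mat_def)
    then have "eigenvalue ?A (B $$ (i, i))"
      using eigenvalue_root_char_poly[OF A] char_poly_similar[OF sim] by simp
    then show ?thesis using \<open>stable_mat M\<close> unfolding stable_mat_def by force
  qed
  have "complex_of_real (mat_trace M) = mat_trace ?A"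
    using M by (simp add: mat_trace_def)
  then have "\<bar>mat_trace M\<bar> = cmod (mat_trace B)"
    using tr by (metis norm_of_real real_norm_def)
  also have "\<dots> \<le> (\<Sum>i<n. cmod (B $$ (i, i)))"
    using B unfolding mat_trace_def by (auto intro: norm_sum)
  also have "\<dots> \<le> (\<Sum>i<n. 1)" by (intro sum_mono ev) simp
  finally show ?thesis by simp
qed

lemma smult_pow_mat:
  fixes A :: "'a :: comm_semiring_1 mat"
  assumes "A \<in> carrier_mat n n"
  shows "(k \<cdot>\<^sub>m A) ^\<^sub>m N = k ^ N \<cdot>\<^sub>m A ^\<^sub>m N"
proof (induction N)
  case 0
  then show ?case by (intro eq_matI) auto
next
  case (Suc N)
  have "(k \<cdot>\<^sub>m A) ^\<^sub>m Suc N = k ^ N \<cdot>\<^sub>m A ^\<^sub>m N * (k \<cdot>\<^sub>m A)" using Suc by simp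
  also have "\<dots> = k ^ N \<cdot>\<^sub>m (k \<cdot>\<^sub>m (A ^\<^sub>m N * A))"
    using assms pow_carrier_mat[OF assms, of N]
    by (metis mult_smult_assoc_mat mult_smult_distrib smult_carrier_mat)
  also have "\<dots> = k ^ Suc N \<cdot>\<^sub>m A ^\<^sub>m Suc N"
    by (intro eq_matI) (auto simp: mult_ac)
  finally show ?case .
qed

text \<open>Nothing ties the dimensions of \<open>F N\<close> to those of \<open>L\<close>; the
  lemmas that rely on them carry them as separate hypotheses.\<close>

definition mat_tendsto :: "(nat \<Rightarrow> real mat) \<Rightarrow> real mat \<Rightarrow> bool" where
  "mat_tendsto F L \<longleftrightarrow>
     (\<forall>i < dim_row L. \<forall>j < dim_col L. (\<lambda>N. F N $$ (i, j)) \<longlonglongrightarrow> L $$ (i, j))"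

lemma mat_tendsto_const: "mat_tendsto (\<lambda>_. A) A"
  by (simp add: mat_tendsto_def)

lemma mat_tendsto_mult:
  assumes "mat_tendsto F A" "mat_tendsto G B"
    and A: "A \<in> carrier_mat nr n" and B: "B \<in> carrier_mat n nc"
    and F: "\<And>N. F N \<in> carrier_mat nr n" and G: "\<And>N. G N \<in> carrier_mat n nc"
  shows "mat_tendsto (\<lambda>N. F N * G N) (A * B)"
  unfolding mat_tendsto_def
proof (intro allI impI)
  fix i j assume "i < dim_row (A * B)" "j < dim_col (A * B)"
  then have ij: "i < nr" "j < nc" using A B by auto
  show "(\<lambda>N. (F N * G N) $$ (i, j)) \<longlonglongrightarrow> (A * B) $$ (i, j)"
    unfolding index_mult_mat_sum[OF A B ij] index_mult_mat_sum[OF F G ij]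
    using assms(1,2) ij A B
    by (intro tendsto_sum tendsto_mult) (auto simp: mat_tendsto_def)
qed

lemma mat_tendsto_transpose:
  assumes "mat_tendsto F A" "A \<in> carrier_mat nr nc" "\<And>N. F N \<in> carrier_mat nr nc"
  shows "mat_tendsto (\<lambda>N. (F N)\<^sup>T) (A\<^sup>T)"
  using assms(1,2) carrier_matD[OF assms(3)] by (auto simp: mat_tendsto_def)

lemma mat_tendsto_unique:
  fixes A B :: "real mat"
  assumes "mat_tendsto F A" "mat_tendsto F B" "A \<in> carrier_mat nr nc" "B \<in> carrier_mat nr nc"
  shows "A = B"
proof (intro eq_matI)
  fix i j assume "i < dim_row B" "j < dim_col B"
  then have "(\<lambda>N. F N $$ (i, j)) \<longlonglongrightarrow> A $$ (i, j)" "(\<lambda>N. F N $$ (i, j)) \<longlonglongrightarrow> B $$ (i, j)"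
    using assms by (auto simp: mat_tendsto_def)
  then show "A $$ (i, j) = B $$ (i, j)" by (rule LIMSEQ_unique)
qed (use assms in auto)

lemma mat_tendsto_trace:
  assumes "mat_tendsto F A" "A \<in> carrier_mat n n" "\<And>N. F N \<in> carrier_mat n n"
  shows "(\<lambda>N. mat_trace (F N)) \<longlonglongrightarrow> mat_trace A"
  using assms(1,2) carrier_matD[OF assms(3)]
  by (auto simp: mat_trace_def mat_tendsto_def intro!: tendsto_sum)

text \<open>Dividing by a number \<open>r\<close> strictly between the spectral radius and one
  leaves the spectral radius below one. The powers of the rescaled matrix are therefore bounded, and
  the entries of the original powers decay like \<open>r ^ N\<close>.\<close>

lemma stable_mat_powers_tendsto_zero:
  assumes M: "M \<in> carrier_mat n n" and stable: "stable_mat M"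
  shows "mat_tendsto (\<lambda>N. M ^\<^sub>m N) (0\<^sub>m n n)"
\<comment> \<open>The spectral radius is a maximum over the spectrum, which is nonempty only in
  positive dimension.\<close>
proof (cases "n = 0")
  case False
  let ?A = "map_mat complex_of_real M"
  have A: "?A \<in> carrier_mat n n" using M by simp
  define \<rho> where "\<rho> = spectral_radius ?A"
  have mem: "\<rho> \<in> norm ` spectrum ?A"
    and max: "a \<in> norm ` spectrum ?A \<Longrightarrow> a \<le> \<rho>" for a
    using spectral_radius_mem_max[OF A] False by (auto simp: \<rho>_def)
  have \<rho>: "0 \<le> \<rho>" "\<rho> < 1"
    using mem stable by (auto simp: spectrum_def stable_mat_def)
  define r where "r = (\<rho> + 1) / 2"
  have r: "\<rho> < r" "0 < r" "r < 1" using \<rho> by (auto simp: r_def)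
  define B where "B = complex_of_real (1 / r) \<cdot>\<^sub>m ?A"
  have B: "B \<in> carrier_mat n n" using A by (simp add: B_def)
  have AB: "?A = complex_of_real r \<cdot>\<^sub>m B"
    using r by (intro eq_matI) (auto simp: B_def)
  \<comment> \<open>An eigenvalue \<open>k\<close> of \<open>B\<close> of largest modulus gives the
    eigenvalue \<open>r * k\<close> of the original matrix, so \<open>r * cmod k\<close> is at most
    \<open>\<rho>\<close>, which is less than \<open>r\<close>.\<close>
  have "spectral_radius B < 1"
  proof -
    obtain k where k: "eigenvalue B k" "spectral_radius B = cmod k"
      using spectral_radius_mem_max(1)[OF B] False by (auto simp: spectrum_def)
    then obtain x where x: "x \<in> carrier_vec n" "x \<noteq> 0\<^sub>v n" "B *\<^sub>v x = k \<cdot>\<^sub>v x"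
      using B by (auto simp: eigenvalue_def eigenvector_def)
    have "?A *\<^sub>v x = complex_of_real r \<cdot>\<^sub>v (B *\<^sub>v x)"
      unfolding AB using B x(1) by (intro eq_vecI) auto
    also have "\<dots> = (complex_of_real r * k) \<cdot>\<^sub>v x" using x by (simp add: smult_smult_assoc)
    finally have "eigenvalue ?A (complex_of_real r * k)"
      using x A by (auto simp: eigenvalue_def eigenvector_def)
    then have "r * cmod k \<le> \<rho>"
      using max[of "r * cmod k"] r by (force simp: spectrum_def norm_mult image_iff)
    then show ?thesis using r k(2) by (smt (verit) mult_less_cancel_left1 mult_le_cancel_left1)
  qed
  then obtain c where c: "\<And>N. norm_bound (B ^\<^sub>m N) c"
    using spectral_radius_jnf_norm_bound_less_1_upper_triangular[OF B] by blast
  show ?thesis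
    unfolding mat_tendsto_def
  proof (intro allI impI)
    fix i j assume "i < dim_row (0\<^sub>m n n :: real mat)" "j < dim_col (0\<^sub>m n n :: real mat)"
    then have ij: "i < n" "j < n" by auto
    have bound: "norm ((M ^\<^sub>m N) $$ (i, j)) \<le> r ^ N * c" for N
    proof -
      have MN: "M ^\<^sub>m N \<in> carrier_mat n n" and BN: "B ^\<^sub>m N \<in> carrier_mat n n"
        using M B pow_carrier_mat by blast+
      have "complex_of_real ((M ^\<^sub>m N) $$ (i, j)) = (?A ^\<^sub>m N) $$ (i, j)"
        using ij carrier_matD[OF MN] by (simp flip: of_real_hom.mat_hom_pow[OF M])
      also have "\<dots> = complex_of_real r ^ N * (B ^\<^sub>m N) $$ (i, j)"
        unfolding AB smult_pow_mat[OF B] using ij carrier_matD[OF BN] by simp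
      finally have "norm ((M ^\<^sub>m N) $$ (i, j)) = r ^ N * cmod ((B ^\<^sub>m N) $$ (i, j))"
        using r by (metis abs_of_pos norm_mult norm_of_real norm_power real_norm_def)
      also have "\<dots> \<le> r ^ N * c"
        using c[of N] ij carrier_matD[OF BN] r by (intro mult_left_mono) (auto simp: norm_bound_def simp del: pow_mat_dim)
      finally show ?thesis .
    qed
    have "(\<lambda>N. r ^ N * c) \<longlonglongrightarrow> 0"
      using r by (intro tendsto_mult_left_zero LIMSEQ_realpow_zero) auto
    then have "(\<lambda>N. (M ^\<^sub>m N) $$ (i, j)) \<longlonglongrightarrow> 0"
      by (rule metric_tendsto_imp_tendsto) (auto intro!: always_eventually order_trans[OF bound[unfolded real_norm_def] abs_ge_self])
    then show "(\<lambda>N. (M ^\<^sub>m N) $$ (i, j)) \<longlonglongrightarrow> 0\<^sub>m n n $$ (i, j)" using ij by simp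
  qed
qed (simp add: mat_tendsto_def)

section \<open>Lyapunov equations and linear systems\<close>

lemma index_mult_mat_sum3:
  fixes A B C :: "'a :: comm_semiring_0 mat"
  assumes A: "A \<in> carrier_mat nr n" and B: "B \<in> carrier_mat n m" and C: "C \<in> carrier_mat m nc"
    and i: "i < nr" and j: "j < nc"
  shows "(A * B * C) $$ (i, j) =
    (\<Sum>(k, l)\<in>{..<n} \<times> {..<m}. A $$ (i, k) * B $$ (k, l) * C $$ (l, j))"
proof -
  have "(A * B * C) $$ (i, j) = (\<Sum>l<m. (\<Sum>k<n. A $$ (i, k) * B $$ (k, l)) * C $$ (l, j))"
    using index_mult_mat_sum[OF mult_carrier_mat[OF A B] C i j] index_mult_mat_sum[OF A B i]
    by simp
  also have "\<dots> = (\<Sum>k<n. \<Sum>l<m. A $$ (i, k) * B $$ (k, l) * C $$ (l, j))"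
    by (simp add: sum_distrib_right sum.swap[of _ "{..<m}"])
  finally show ?thesis by (simp add: sum.cartesian_product)
qed

lemma stable_mat_transpose:
  assumes M: "M \<in> carrier_mat n n" and stable: "stable_mat M"
  shows "stable_mat (M\<^sup>T)"
proof -
  let ?A = "map_mat complex_of_real M"
  have A: "?A \<in> carrier_mat n n" and AT: "?A\<^sup>T \<in> carrier_mat n n" using M by auto
  have "map_mat complex_of_real (M\<^sup>T) = ?A\<^sup>T" by (intro eq_matI) auto
  then show ?thesis
    using stable M
    unfolding stable_mat_def eigenvalue_root_char_poly[OF A] eigenvalue_root_char_poly[OF AT]
    by (simp add: char_poly_transpose_mat[OF A] eigenvalue_root_char_poly[OF A] eigenvalue_root_char_poly[OF AT])
qed

lemma pow_mat_commute:
  assumes "A \<in> carrier_mat n n"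
  shows "A * A ^\<^sub>m N = A ^\<^sub>m N * A"
proof (induction N)
  case (Suc N)
  then show ?case
    using assoc_mult_mat[OF assms pow_carrier_mat[OF assms] assms, of N] by simp
qed (use assms in simp)

lemma transpose_mult_congruence:
  fixes A B P :: "'a :: comm_semiring_1 mat"
  assumes A: "A \<in> carrier_mat a b" and B: "B \<in> carrier_mat b c" and P: "P \<in> carrier_mat a a"
  shows "(A * B)\<^sup>T * P * (A * B) = B\<^sup>T * (A\<^sup>T * P * A) * B"
proof -
  have AT: "A\<^sup>T \<in> carrier_mat b a" and BT: "B\<^sup>T \<in> carrier_mat c b" using A B by auto
  have ATP: "A\<^sup>T * P \<in> carrier_mat b a" using AT P by simp
  have "(A * B)\<^sup>T * P * (A * B) = B\<^sup>T * (A\<^sup>T * P) * (A * B)"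
    unfolding transpose_mult[OF A B] assoc_mult_mat[OF BT AT P] ..
  also have "\<dots> = B\<^sup>T * (A\<^sup>T * P) * A * B"
    using assoc_mult_mat[OF mult_carrier_mat[OF BT ATP] A B] by simp
  also have "\<dots> = B\<^sup>T * (A\<^sup>T * P * A) * B"
    unfolding assoc_mult_mat[OF BT ATP A] ..
  finally show ?thesis .
qed

lemma gram_mult:
  fixes A B :: "'a :: comm_semiring_1 mat"
  assumes A: "A \<in> carrier_mat a b" and B: "B \<in> carrier_mat b c"
  shows "(A * B)\<^sup>T * (A * B) = B\<^sup>T * (A\<^sup>T * A) * B"
  using transpose_mult_congruence[OF A B one_carrier_mat] A B by simp

text \<open>Iterating the fixed point equation sandwiches \<open>A\<close> between arbitrarily high
  powers of \<open>M\<close>, and these tend to zero.\<close>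

lemma stein_homogeneous_zero:
  assumes M: "M \<in> carrier_mat n n" and stable: "stable_mat M"
    and A: "A \<in> carrier_mat n n" and fixp: "M\<^sup>T * A * M = A"
  shows "A = 0\<^sub>m n n"
proof -
  note MN = pow_carrier_mat[OF M]
  have eq: "(M ^\<^sub>m N)\<^sup>T * A * M ^\<^sub>m N = A" for N
  proof (induction N)
    case (Suc N)
    have "(M ^\<^sub>m Suc N)\<^sup>T * A * M ^\<^sub>m Suc N = M\<^sup>T * ((M ^\<^sub>m N)\<^sup>T * A * M ^\<^sub>m N) * M"
      using transpose_mult_congruence[OF MN M A] by simp
    then show ?case using Suc fixp by simp
  qed (use M A in simp)
  have lim: "mat_tendsto (\<lambda>N. M ^\<^sub>m N) (0\<^sub>m n n)"
    by (rule stable_mat_powers_tendsto_zero[OF M stable])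
  have "mat_tendsto (\<lambda>N. (M ^\<^sub>m N)\<^sup>T * A * M ^\<^sub>m N) ((0\<^sub>m n n)\<^sup>T * A * 0\<^sub>m n n)"
    using A MN
    by (intro mat_tendsto_mult[where nr = n and n = n and nc = n] mat_tendsto_const
      mat_tendsto_transpose[OF lim, of n n] lim mult_carrier_mat[where n = n]) auto
  then show ?thesis
    using mat_tendsto_unique[OF mat_tendsto_const, of A _ n n] A unfolding eq by simp
qed

text \<open>
  A matrix \<open>A\<close> annihilating the range of \<open>P \<mapsto> M\<^sup>T P M - P\<close> satisfies \<open>M A M\<^sup>T = A\<close>, hence is zero, so
  the Fredholm alternative applies.
\<close>

lemma lyapunov_equation_solvable:
  assumes M: "M \<in> carrier_mat n n" and stable: "stable_mat M"
    and H: "H \<in> carrier_mat n n"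
  shows "\<exists>P\<in>carrier_mat n n. M\<^sup>T * P * M - P + H = 0\<^sub>m n n"
proof -
  let ?I = "{..<n} \<times> {..<n}"
  \<comment> \<open>\<open>v (k, l)\<close> holds the entries of the image of the
    \<open>(k, l)\<close> matrix unit under the operator to be inverted. The coefficients produced
    by the Fredholm alternative are therefore the entries of \<open>P\<close>.\<close>
  define v where "v = (\<lambda>(k, l) (i, j). M $$ (k, i) * M $$ (l, j) - (if (k, l) = (i, j) then 1 else 0))"
  have "\<exists>c. \<forall>q\<in>?I. (\<lambda>(i, j). - H $$ (i, j)) q = (\<Sum>k\<in>?I. c k * v k q)"
  proof (rule finite_fredholm_alternative)
    fix a
    assume a: "(\<Sum>q\<in>?I. a q * v k q) = 0" if "k \<in> ?I" for k
    define A where "A = mat n n a"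
    have A: "A \<in> carrier_mat n n" by (simp add: A_def)
    have "(M * A * M\<^sup>T) $$ (k, l) = A $$ (k, l)" if kl: "k < n" "l < n" for k l
    proof -
      have "(M * A * M\<^sup>T) $$ (k, l) = (\<Sum>(i, j)\<in>?I. M $$ (k, i) * a (i, j) * M $$ (l, j))"
        using M A kl by (subst index_mult_mat_sum3[of _ n n _ n _ n]) (auto simp: A_def intro!: sum.cong)
      \<comment> \<open>The \<open>if\<close> term adds back the identity part of \<open>v\<close>:
        the annihilation hypothesis removes the first sum and the single entry
        \<open>a (k, l)\<close> remains.\<close>
      also have "\<dots> = (\<Sum>q\<in>?I. a q * v (k, l) q + (if q = (k, l) then a q else 0))"
        by (intro sum.cong) (auto simp: v_def algebra_simps split: if_splits)
      also have "\<dots> = a (k, l)"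
        unfolding sum.distrib using a[of "(k, l)"] kl by (simp add: sum.delta)
      finally show ?thesis using kl by (simp add: A_def)
    qed
    then have "M * A * M\<^sup>T = A"
      using M A by (intro eq_matI) (simp_all del: index_mult_mat(1))
    then have "A = 0\<^sub>m n n"
      using stein_homogeneous_zero[of "M\<^sup>T" n A] stable_mat_transpose[OF M stable] M A by simp
    then have "A $$ q = 0" if "q \<in> ?I" for q using that by auto
    then have "a q = 0" if "q \<in> ?I" for q using that by (auto simp: A_def)
    then show "(\<Sum>q\<in>?I. a q * (\<lambda>(i, j). - H $$ (i, j)) q) = 0" by simp
  qed auto
  then obtain c where c: "\<And>i j. i < n \<Longrightarrow> j < n \<Longrightarrow> - H $$ (i, j) = (\<Sum>k\<in>?I. c k * v k (i, j))"
    by (force simp: mem_Times_iff)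
  define P where "P = mat n n c"
  have P: "P \<in> carrier_mat n n" by (simp add: P_def)
  have "(M\<^sup>T * P * M) $$ (i, j) - P $$ (i, j) + H $$ (i, j) = 0" if ij: "i < n" "j < n" for i j
  proof -
    have "(M\<^sup>T * P * M) $$ (i, j) = (\<Sum>(k, l)\<in>?I. M $$ (k, i) * c (k, l) * M $$ (l, j))"
      using M P ij by (subst index_mult_mat_sum3[of _ n n _ n _ n]) (auto simp: P_def intro!: sum.cong)
    also have "\<dots> = (\<Sum>q\<in>?I. c q * v q (i, j) + (if q = (i, j) then c q else 0))"
      by (intro sum.cong) (auto simp: v_def algebra_simps split: if_splits)
    also have "\<dots> = - H $$ (i, j) + c (i, j)"
      unfolding sum.distrib using c[OF ij] ij by (simp add: sum.delta)
    finally show ?thesis using ij by (simp add: P_def)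
  qed
  then have "M\<^sup>T * P * M - P + H = 0\<^sub>m n n" using M P H by (intro eq_matI) auto
  then show ?thesis using P by blast
qed

text \<open>The inhomogeneous term cancels in the difference of two solutions, which leaves a
  homogeneous Stein equation.\<close>

lemma lyapunov_solution_unique:
  assumes M: "M \<in> carrier_mat n n" and stable: "stable_mat M" and H: "H \<in> carrier_mat n n"
    and P: "P \<in> carrier_mat n n" and Q: "Q \<in> carrier_mat n n"
    and solP: "M\<^sup>T * P * M - P + H = 0\<^sub>m n n" and solQ: "M\<^sup>T * Q * M - Q + H = 0\<^sub>m n n"
  shows "Q = P"
proof -
  have "M\<^sup>T * (Q - P) * M = M\<^sup>T * Q * M - M\<^sup>T * P * M"
    using M P Q by (simp add: minus_mult_distrib_mat[of _ n n _ _ n] mult_minus_distrib_mat[of _ n n _ n])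
  also have "\<dots> = Q - P"
  proof (intro eq_matI)
    fix i j assume "i < dim_row (Q - P)" "j < dim_col (Q - P)"
    then have ij: "i < n" "j < n" using P by auto
    have "(M\<^sup>T * P * M) $$ (i, j) - P $$ (i, j) + H $$ (i, j) = 0"
      "(M\<^sup>T * Q * M) $$ (i, j) - Q $$ (i, j) + H $$ (i, j) = 0"
      using arg_cong[OF solP, of "\<lambda>B. B $$ (i, j)"] arg_cong[OF solQ, of "\<lambda>B. B $$ (i, j)"]
        ij M P Q H by auto
    then show "(M\<^sup>T * Q * M - M\<^sup>T * P * M) $$ (i, j) = (Q - P) $$ (i, j)"
      using ij M P Q by simp
  qed (use M P Q in auto)
  finally have "Q - P = 0\<^sub>m n n"
    by (intro stein_homogeneous_zero[OF M stable]) (use P in auto)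
  then have "(Q - P) $$ (i, j) = 0" if "i < n" "j < n" for i j using that by simp
  then show ?thesis using P Q by (intro eq_matI) auto
qed

lemma mat_trace_minus:
  fixes A B :: "'a :: ab_group_add mat"
  assumes "A \<in> carrier_mat n n" "B \<in> carrier_mat n n"
  shows "mat_trace (A - B) = mat_trace A - mat_trace B"
  using assms by (simp add: mat_trace_def sum_subtractf)

text \<open>Replacing \<open>G\<^sup>T * G\<close> by \<open>P - M\<^sup>T * P * M\<close> makes
  each summand the drop of the quadratic form of \<open>P\<close> along one step of the trajectory
  \<open>M ^\<^sub>m t * E\<close>. The series telescopes, and stability sends the remaining end
  term to zero.\<close>

lemma lyapunov_cost_sums:
  assumes M: "M \<in> carrier_mat n n" and stable: "stable_mat M"
    and G: "G \<in> carrier_mat p n" and E: "E \<in> carrier_mat n d" and P: "P \<in> carrier_mat n n"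
    and sol: "M\<^sup>T * P * M - P + G\<^sup>T * G = 0\<^sub>m n n"
  shows "(\<lambda>t. mat_trace ((G * M ^\<^sub>m t * E)\<^sup>T * (G * M ^\<^sub>m t * E))) sums mat_trace (E\<^sup>T * P * E)"
proof -
  note MN = pow_carrier_mat[OF M]
  define Y where "Y = (\<lambda>t. M ^\<^sub>m t * E)"
  have Y: "Y t \<in> carrier_mat n d" for t using mult_carrier_mat[OF MN E] by (simp add: Y_def)
  have carr: "(Y t)\<^sup>T * P * Y t \<in> carrier_mat d d" for t
    using Y P by (intro mult_carrier_mat[where n = n]) auto
  define g where "g = (\<lambda>t. mat_trace ((Y t)\<^sup>T * P * Y t))"
  have GG: "G\<^sup>T * G = P - M\<^sup>T * P * M"
  proof (intro eq_matI)
    fix i j assume "i < dim_row (P - M\<^sup>T * P * M)" "j < dim_col (P - M\<^sup>T * P * M)"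
    then have ij: "i < n" "j < n" using M by auto
    then show "(G\<^sup>T * G) $$ (i, j) = (P - M\<^sup>T * P * M) $$ (i, j)"
      using arg_cong[OF sol, of "\<lambda>B. B $$ (i, j)"] M P G by simp
  qed (use M G in auto)
  have "mat_trace ((G * M ^\<^sub>m t * E)\<^sup>T * (G * M ^\<^sub>m t * E)) = g t - g (Suc t)" for t
  proof -
    \<comment> \<open>A matrix power gains its new factor on the right; commuting that factor to the
      left gives the state recursion.\<close>
    have YS: "Y (Suc t) = M * Y t"
      using M E MN[of t] pow_mat_commute[OF M, of t] by (simp add: Y_def flip: assoc_mult_mat[of _ n n _ n])
    have "G * M ^\<^sub>m t * E = G * Y t" using G E MN[of t] by (simp add: Y_def)
    then have "(G * M ^\<^sub>m t * E)\<^sup>T * (G * M ^\<^sub>m t * E) = (Y t)\<^sup>T * (G\<^sup>T * G) * Y t"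
      using gram_mult[OF G Y] by simp
    also have "\<dots> = (Y t)\<^sup>T * P * Y t - (Y t)\<^sup>T * (M\<^sup>T * P * M) * Y t"
      unfolding GG using M P Y[of t]
      by (simp add: minus_mult_distrib_mat[of _ d n _ _ d] mult_minus_distrib_mat[of _ d n _ n])
    also have "(Y t)\<^sup>T * (M\<^sup>T * P * M) * Y t = (Y (Suc t))\<^sup>T * P * Y (Suc t)"
      unfolding YS transpose_mult_congruence[OF M Y P] ..
    finally show ?thesis
      unfolding g_def using carr[of t] carr[of "Suc t"] by (simp add: mat_trace_minus[of _ d])
  qed
  moreover have "g \<longlonglongrightarrow> mat_trace ((0\<^sub>m n d)\<^sup>T * P * 0\<^sub>m n d)"
  proof -
    have "mat_tendsto Y (0\<^sub>m n n * E)"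
      unfolding Y_def using MN E
      by (intro mat_tendsto_mult[where nr = n and n = n and nc = d] mat_tendsto_const
        stable_mat_powers_tendsto_zero[OF M stable]) auto
    then have lim: "mat_tendsto Y (0\<^sub>m n d)" using E by simp
    have YP: "(Y t)\<^sup>T * P \<in> carrier_mat d n" for t using Y P by (intro mult_carrier_mat[where n = n]) auto
    have "mat_tendsto (\<lambda>t. (Y t)\<^sup>T * P) ((0\<^sub>m n d)\<^sup>T * P)"
      by (rule mat_tendsto_mult[OF mat_tendsto_transpose[OF lim _ Y] mat_tendsto_const, where nr = d and n = n and nc = n])
        (use Y P in auto)
    then have "mat_tendsto (\<lambda>t. (Y t)\<^sup>T * P * Y t) ((0\<^sub>m n d)\<^sup>T * P * 0\<^sub>m n d)"
      by (rule mat_tendsto_mult[OF _ lim, where nr = d and n = n and nc = d])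
        (use Y P YP in auto)
    then show ?thesis
      unfolding g_def by (rule mat_tendsto_trace[of _ _ d]) (use P carr in auto)
  qed
  then have "g \<longlonglongrightarrow> 0" using P by (simp add: mat_trace_def)
  moreover have "g 0 = mat_trace (E\<^sup>T * P * E)"
    using M E by (simp add: g_def Y_def)
  ultimately show ?thesis using telescope_sums'[of g 0] by simp
qed

section \<open>Stacked linear systems\<close>

text \<open>The Fredholm alternative is applied to each column of the right-hand side, with the rows
  of the three blocks as coordinates. Annihilators are matrices with \<open>r\<close> rows rather
  than single row vectors, so that directions in the set of explaining systems can be used as they
  are.\<close>

lemma stacked_mat_solvable:
  fixes X U W :: "real mat"
  assumes X: "X \<in> carrier_mat n1 T" and U: "U \<in> carrier_mat n2 T" and W: "W \<in> carrier_mat n3 T"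
    and Y1: "Y1 \<in> carrier_mat n1 k" and Y2: "Y2 \<in> carrier_mat n2 k" and Y3: "Y3 \<in> carrier_mat n3 k"
    and r: "k > 0 \<Longrightarrow> r > 0"
    and ann: "\<And>A B E. \<lbrakk>A \<in> carrier_mat r n1; B \<in> carrier_mat r n2; E \<in> carrier_mat r n3;
      A * X + B * U + E * W = 0\<^sub>m r T\<rbrakk> \<Longrightarrow> A * Y1 + B * Y2 + E * Y3 = 0\<^sub>m r k"
  shows "\<exists>R\<in>carrier_mat T k. X * R = Y1 \<and> U * R = Y2 \<and> W * R = Y3"
proof -
  define I where "I = {..<n1} <+> {..<n2} <+> {..<n3}"
  define ev where "ev = (\<lambda>(F :: real mat) (G :: real mat) (H :: real mat) (j :: nat).
    case_sum (\<lambda>i. F $$ (i, j)) (case_sum (\<lambda>i. G $$ (i, j)) (\<lambda>i. H $$ (i, j))))"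
  have split: "(\<Sum>q\<in>I. a q * ev F G H j q) = (\<Sum>i<n1. a (Inl i) * F $$ (i, j)) +
      (\<Sum>i<n2. a (Inr (Inl i)) * G $$ (i, j)) + (\<Sum>i<n3. a (Inr (Inr i)) * H $$ (i, j))" for a F G H j
    by (simp add: I_def ev_def sum.Plus add.assoc)
  have "\<exists>c. \<forall>q\<in>I. ev Y1 Y2 Y3 j q = (\<Sum>t<T. c t * ev X U W t q)" if j: "j < k" for j
  proof (rule finite_fredholm_alternative)
    fix a
    assume a: "(\<Sum>q\<in>I. a q * ev X U W t q) = 0" if "t \<in> {..<T}" for t
    \<comment> \<open>The annihilating row vector is copied into all \<open>r\<close> rows.\<close>
    define A B E where "A = mat r n1 (\<lambda>(_, i). a (Inl i))" and
      "B = mat r n2 (\<lambda>(_, i). a (Inr (Inl i)))" and "E = mat r n3 (\<lambda>(_, i). a (Inr (Inr i)))"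
    have car: "A \<in> carrier_mat r n1" "B \<in> carrier_mat r n2" "E \<in> carrier_mat r n3"
      by (auto simp: A_def B_def E_def)
    have rows: "i < r \<Longrightarrow> q < n1 \<Longrightarrow> A $$ (i, q) = a (Inl q)"
      "i < r \<Longrightarrow> q < n2 \<Longrightarrow> B $$ (i, q) = a (Inr (Inl q))"
      "i < r \<Longrightarrow> q < n3 \<Longrightarrow> E $$ (i, q) = a (Inr (Inr q))" for i q
      by (auto simp: A_def B_def E_def)
    have entry: "(A * F + B * G + E * H) $$ (i, t) = (\<Sum>q\<in>I. a q * ev F G H t q)"
      if "F \<in> carrier_mat n1 l" "G \<in> carrier_mat n2 l" "H \<in> carrier_mat n3 l" "i < r" "t < l"
      for F G H i t l
    proof -
      have "(A * F) $$ (i, t) = (\<Sum>i<n1. a (Inl i) * F $$ (i, t))"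
        "(B * G) $$ (i, t) = (\<Sum>i<n2. a (Inr (Inl i)) * G $$ (i, t))"
        "(E * H) $$ (i, t) = (\<Sum>i<n3. a (Inr (Inr i)) * H $$ (i, t))"
        using that by (simp_all add: index_mult_mat_sum[OF car(1)] index_mult_mat_sum[OF car(2)]
          index_mult_mat_sum[OF car(3)] rows del: index_mult_mat(1))
      then show ?thesis unfolding split using that car by (simp del: index_mult_mat(1))
    qed
    have "A * X + B * U + E * W = 0\<^sub>m r T"
      using entry[OF X U W] a car X U W by (intro eq_matI) (auto simp del: index_mult_mat(1) index_add_mat(1))
    then have "A * Y1 + B * Y2 + E * Y3 = 0\<^sub>m r k" by (rule ann[OF car])
    \<comment> \<open>Row 0 exists because \<open>j < k\<close> makes \<open>k\<close> and hence
      \<open>r\<close> positive.\<close>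
    then have "(A * Y1 + B * Y2 + E * Y3) $$ (0, j) = 0" using r j by simp
    then show "(\<Sum>q\<in>I. a q * ev Y1 Y2 Y3 j q) = 0"
      using entry[OF Y1 Y2 Y3, of 0 j] r j by simp
  qed (auto simp: I_def)
  then obtain c where c: "\<And>j q. j < k \<Longrightarrow> q \<in> I \<Longrightarrow> ev Y1 Y2 Y3 j q = (\<Sum>t<T. c j t * ev X U W t q)"
    by metis
  define R where "R = mat T k (\<lambda>(t, j). c j t)"
  have R: "R \<in> carrier_mat T k" by (simp add: R_def)
  have solves: "F * R = Y"
    if F: "F \<in> carrier_mat l T" and Y: "Y \<in> carrier_mat l k"
      and entry: "\<And>i j. i < l \<Longrightarrow> j < k \<Longrightarrow> Y $$ (i, j) = (\<Sum>t<T. c j t * F $$ (i, t))" for F Y l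
  proof (intro eq_matI)
    fix i j assume "i < dim_row Y" "j < dim_col Y"
    then have ij: "i < l" "j < k" using Y by auto
    then show "(F * R) $$ (i, j) = Y $$ (i, j)"
      unfolding index_mult_mat_sum[OF F R ij] entry[OF ij]
      by (intro sum.cong) (auto simp: R_def)
  qed (use F R Y in auto)
  have "X * R = Y1"
    by (rule solves[OF X Y1]) (use c[of _ "Inl _"] in \<open>auto simp: I_def ev_def\<close>)
  moreover have "U * R = Y2"
    by (rule solves[OF U Y2]) (use c[of _ "Inr (Inl _)"] in \<open>auto simp: I_def ev_def\<close>)
  moreover have "W * R = Y3"
    by (rule solves[OF W Y3]) (use c[of _ "Inr (Inr _)"] in \<open>auto simp: I_def ev_def\<close>)
  ultimately show ?thesis using R by blast
qed

section \<open>Informativity\<close>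

lemma append_rows_mult:
  fixes A B R :: "'a :: semiring_1 mat"
  assumes A: "A \<in> carrier_mat nr1 nc" and B: "B \<in> carrier_mat nr2 nc" and R: "R \<in> carrier_mat nc k"
  shows "(A @\<^sub>r B) * R = (A * R) @\<^sub>r (B * R)"
  using A B R by (intro eq_matI) (auto simp: append_rows_def scalar_prod_def intro!: sum.cong)

lemma append_rows_eq_zero_iff:
  assumes A: "A \<in> carrier_mat nr1 nc" and B: "B \<in> carrier_mat nr2 nc"
  shows "A @\<^sub>r B = 0\<^sub>m (nr1 + nr2) nc \<longleftrightarrow> A = 0\<^sub>m nr1 nc \<and> B = 0\<^sub>m nr2 nc"
proof
  assume zero: "A @\<^sub>r B = 0\<^sub>m (nr1 + nr2) nc"
  have "A $$ (i, j) = 0" if "i < nr1" "j < nc" for i j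
    using arg_cong[OF zero, of "\<lambda>M. M $$ (i, j)"] that A B by (simp add: append_rows_def)
  moreover have "B $$ (i, j) = 0" if "i < nr2" "j < nc" for i j
    using arg_cong[OF zero, of "\<lambda>M. M $$ (nr1 + i, j)"] that A B by (simp add: append_rows_def)
  ultimately show "A = 0\<^sub>m nr1 nc \<and> B = 0\<^sub>m nr2 nc"
    using A B by (auto intro!: eq_matI)
next
  assume "A = 0\<^sub>m nr1 nc \<and> B = 0\<^sub>m nr2 nc"
  then show "A @\<^sub>r B = 0\<^sub>m (nr1 + nr2) nc"
    by (auto simp: append_rows_def intro!: eq_matI)
qed

lemma mat_trace_gram:
  fixes N :: "real mat"
  assumes "N \<in> carrier_mat a b"
  shows "mat_trace (N\<^sup>T * N) = (\<Sum>j<b. \<Sum>i<a. (N $$ (i, j))\<^sup>2)"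
  using assms by (auto simp: mat_trace_def scalar_prod_def lessThan_atLeast0 power2_eq_square
      intro!: sum.cong)

lemma mat_trace_gram_nonneg: "mat_trace ((N :: real mat)\<^sup>T * N) \<ge> 0"
  by (subst mat_trace_gram[of _ "dim_row N" "dim_col N"]) (auto intro!: sum_nonneg)

text \<open>This passes from traces to entries: a matrix with zero Gram trace vanishes, and a bound
  on the cost bounds every entry of the first response.\<close>

lemma entry_square_le_trace_gram:
  fixes N :: "real mat"
  assumes "N \<in> carrier_mat a b" "i < a" "j < b"
  shows "(N $$ (i, j))\<^sup>2 \<le> mat_trace (N\<^sup>T * N)"
proof -
  have "(N $$ (i, j))\<^sup>2 \<le> (\<Sum>i<a. (N $$ (i, j))\<^sup>2)"
    using assms by (intro member_le_sum) auto
  also have "\<dots> \<le> (\<Sum>j<b. \<Sum>i<a. (N $$ (i, j))\<^sup>2)"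
    using assms by (intro member_le_sum[of j "{..<b}" "\<lambda>j. \<Sum>i<a. (N $$ (i, j))\<^sup>2"]) (auto intro: sum_nonneg)
  finally show ?thesis using assms by (simp add: mat_trace_gram)
qed

text \<open>Traces of closed loops and entries of the first response are affine along a line of
  systems, so a uniform bound on them forces the direction's contribution to vanish.\<close>

lemma bounded_affine_slope_zero:
  fixes a b c :: real
  assumes "\<And>s. \<bar>a + s * b\<bar> \<le> c"
  shows "b = 0"
proof (rule ccontr)
  assume "b \<noteq> 0"
  then have "a + ((c + 1 - a) / b) * b = c + 1" by simp
  then show False using assms[of "(c + 1 - a) / b"] by simp
qed

lemma h2_cost_eq_lyapunov_trace:
  assumes "A \<in> carrier_mat n n" "B \<in> carrier_mat n m" "E \<in> carrier_mat n d"
    and "C \<in> carrier_mat p n" "D \<in> carrier_mat p m" "K \<in> carrier_mat m n"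
    and "stable_mat (A + B * K)" and "P \<in> carrier_mat n n"
    and "(A + B * K)\<^sup>T * P * (A + B * K) - P + (C + D * K)\<^sup>T * (C + D * K) = 0\<^sub>m n n"
  shows "h2_cost C D (A, B, E) K = mat_trace (E\<^sup>T * P * E)"
  using lyapunov_cost_sums[of "A + B * K" n "C + D * K" p E d P] assms
  by (simp add: h2_cost_def closed_loop_response_def sums_iff)

text \<open>The left side is the summand at time zero of a series with nonnegative terms. A Lyapunov
  solution is constructed in order to obtain summability.\<close>

lemma initial_response_le_h2_cost:
  assumes car: "A \<in> carrier_mat n n" "B \<in> carrier_mat n m" "E \<in> carrier_mat n d"
    "C \<in> carrier_mat p n" "D \<in> carrier_mat p m" "K \<in> carrier_mat m n"
    and stable: "stable_mat (A + B * K)"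
  shows "mat_trace (((C + D * K) * E)\<^sup>T * ((C + D * K) * E)) \<le> h2_cost C D (A, B, E) K"
proof -
  let ?M = "A + B * K" and ?G = "C + D * K"
  have M: "?M \<in> carrier_mat n n" and G: "?G \<in> carrier_mat p n" using car by auto
  have "?G\<^sup>T * ?G \<in> carrier_mat n n" using G by auto
  from lyapunov_equation_solvable[OF M stable this] obtain P where
    P: "P \<in> carrier_mat n n" "?M\<^sup>T * P * ?M - P + ?G\<^sup>T * ?G = 0\<^sub>m n n" by blast
  let ?f = "\<lambda>t. mat_trace ((?G * ?M ^\<^sub>m t * E)\<^sup>T * (?G * ?M ^\<^sub>m t * E))"
  have "summable ?f"
    using lyapunov_cost_sums[OF M stable G car(3) P] by (rule sums_summable)
  then have "sum ?f {0} \<le> suminf ?f"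
    by (rule sum_le_suminf) (auto intro: mat_trace_gram_nonneg)
  moreover have "?G * ?M ^\<^sub>m 0 * E = ?G * E"
    using M G by (simp del: index_mult_mat index_add_mat)
  ultimately show ?thesis by (simp add: h2_cost_def closed_loop_response_def)
qed

lemma mult_diff_add_distrib_both:
  fixes A B H :: "'a :: comm_ring_1 mat"
  assumes L: "L \<in> carrier_mat a b" and A: "A \<in> carrier_mat b b" and B: "B \<in> carrier_mat b b"
    and H: "H \<in> carrier_mat b b" and R: "R \<in> carrier_mat b c"
  shows "L * (A - B + H) * R = L * A * R - L * B * R + L * H * R"
proof -
  note LA = mult_carrier_mat[OF L A] and LB = mult_carrier_mat[OF L B]
    and LH = mult_carrier_mat[OF L H]
  show ?thesis
    unfolding mult_add_distrib_mat[OF L minus_carrier_mat[OF B] H] mult_minus_distrib_mat[OF L A B]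
      add_mult_distrib_mat[OF minus_carrier_mat[OF LB] LH R] minus_mult_distrib_mat[OF LA LB R] ..
qed

section \<open>The data equation and reformulated conditions\<close>

text \<open>The true system enters through \<open>explained\<close>: some triple fits the data and
  serves as base point for the lines of systems considered below.\<close>

locale input_disturbance_state_data =
  fixes n m d p T :: nat and C D U W X :: "real mat" and \<gamma> :: real
  assumes C: "C \<in> carrier_mat p n" and D: "D \<in> carrier_mat p m"
    and U: "U \<in> carrier_mat m T" and W: "W \<in> carrier_mat d T"
    and X: "X \<in> carrier_mat n (Suc T)"
    and explained: "explaining_systems U W X \<noteq> {}" and \<gamma>: "\<gamma> > 0"
begin

abbreviation "Xm \<equiv> past X"
abbreviation "Xp \<equiv> future X"
abbreviation "Z \<equiv> output_data C D U X"

lemma Xm: "Xm \<in> carrier_mat n T" and Xp: "Xp \<in> carrier_mat n T"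
  using X by (auto simp: past_def future_def)

lemma Z: "Z \<in> carrier_mat p T"
  using C D U Xm by (auto simp: output_data_def)

lemma explaining_iff:
  "(A, B, E) \<in> explaining_systems U W X \<longleftrightarrow>
    A \<in> carrier_mat n n \<and> B \<in> carrier_mat n m \<and> E \<in> carrier_mat n d \<and> Xp = A * Xm + B * U + E * W"
  using U W X by (auto simp: explaining_systems_def)

lemma right_inverse_Xm_iff: "right_inverse_mat Xm R \<longleftrightarrow> R \<in> carrier_mat T n \<and> Xm * R = 1\<^sub>m n"
  using Xm by (auto simp: right_inverse_mat_def inverts_mat_def)

lemma right_inverse_W_iff: "right_inverse_mat W V \<longleftrightarrow> V \<in> carrier_mat T d \<and> W * V = 1\<^sub>m d"
  using W by (auto simp: right_inverse_mat_def inverts_mat_def)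

text \<open>Combining samples by \<open>R\<close> in the data equation; suitable choices of
  \<open>R\<close> isolate the closed loop and the disturbance matrix.\<close>

lemma Xp_mult:
  assumes "(A, B, E) \<in> explaining_systems U W X" and R: "R \<in> carrier_mat T k"
  shows "Xp * R = A * (Xm * R) + B * (U * R) + E * (W * R)"
proof -
  from assms(1) have car: "A \<in> carrier_mat n n" "B \<in> carrier_mat n m" "E \<in> carrier_mat n d"
    and eq: "Xp = A * Xm + B * U + E * W" by (auto simp: explaining_iff)
  have prods: "A * Xm \<in> carrier_mat n T" "B * U \<in> carrier_mat n T" "E * W \<in> carrier_mat n T"
    using car Xm U W by auto
  show ?thesis
    unfolding eq add_mult_distrib_mat[OF add_carrier_mat[OF prods(2)] prods(3) R]
      add_mult_distrib_mat[OF prods(1,2) R] assoc_mult_mat[OF car(1) Xm R]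
      assoc_mult_mat[OF car(2) U R] assoc_mult_mat[OF car(3) W R] ..
qed

text \<open>The right side does not mention the system: under the gain \<open>U * R\<close> all
  explaining systems share one closed loop.\<close>

lemma closed_loop_eq:
  assumes "(A, B, E) \<in> explaining_systems U W X" and R: "R \<in> carrier_mat T n"
    and "Xm * R = 1\<^sub>m n" "W * R = 0\<^sub>m d n"
  shows "A + B * (U * R) = Xp * R"
proof -
  from assms(1) have "A \<in> carrier_mat n n" "B \<in> carrier_mat n m" "E \<in> carrier_mat n d"
    by (auto simp: explaining_iff)
  then show ?thesis using Xp_mult[OF assms(1) R] assms U by simp
qed

text \<open>Samples combined so that state and input cancel expose \<open>E\<close>, which is
  thereby the same for all explaining systems.\<close>

lemma disturbance_matrix_eq:
  assumes "(A, B, E) \<in> explaining_systems U W X" and V: "V \<in> carrier_mat T d"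
    and "Xm * V = 0\<^sub>m n d" "U * V = 0\<^sub>m m d" "W * V = 1\<^sub>m d"
  shows "E = Xp * V"
proof -
  from assms(1) have "A \<in> carrier_mat n n" "B \<in> carrier_mat n m" "E \<in> carrier_mat n d"
    by (auto simp: explaining_iff)
  then show ?thesis using Xp_mult[OF assms(1) V] assms by simp
qed

lemma output_eq:
  assumes R: "R \<in> carrier_mat T n" and "Xm * R = 1\<^sub>m n"
  shows "C + D * (U * R) = Z * R"
proof -
  have prods: "C * Xm \<in> carrier_mat p T" "D * U \<in> carrier_mat p T" using C D U Xm by auto
  show ?thesis
    unfolding output_data_def add_mult_distrib_mat[OF prods R] assoc_mult_mat[OF C Xm R]
      assoc_mult_mat[OF D U R] assms(2) using C by simp
qed

lemma condition_i_iff: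
  "condition_i C D U W X R \<longleftrightarrow> R \<in> carrier_mat T n \<and> Xm * R = 1\<^sub>m n \<and> stable_mat (Xp * R) \<and>
     W * R = 0\<^sub>m d n \<and> Z * R = 0\<^sub>m p n"
proof (cases "R \<in> carrier_mat T n")
  case True
  then have "(W @\<^sub>r Z) * R = 0\<^sub>m (d + p) n \<longleftrightarrow> W * R = 0\<^sub>m d n \<and> Z * R = 0\<^sub>m p n"
    using append_rows_mult[OF W Z True] append_rows_eq_zero_iff[of "W * R" d n "Z * R" p] W Z by simp
  then show ?thesis
    using C W X True by (auto simp: condition_i_def right_inverse_Xm_iff)
qed (simp add: condition_i_def right_inverse_Xm_iff)

text \<open>Moving \<open>R\<close> inside the three congruences gives the Lyapunov equation of the
  closed loop \<open>Xp * R\<close> with output matrix \<open>Z * R\<close>; the middle term becomes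
  \<open>P\<close> because \<open>R\<close> is a right inverse of \<open>Xm\<close>.\<close>

lemma lyapunov_solution_iff:
  assumes R: "R \<in> carrier_mat T n" and XR: "Xm * R = 1\<^sub>m n"
  shows "lyapunov_solution C D U X R P \<longleftrightarrow>
    P \<in> carrier_mat n n \<and> (Xp * R)\<^sup>T * P * (Xp * R) - P + (Z * R)\<^sup>T * (Z * R) = 0\<^sub>m n n"
proof (cases "P \<in> carrier_mat n n")
  case True
  have car: "Xp\<^sup>T * P * Xp \<in> carrier_mat T T" "Xm\<^sup>T * P * Xm \<in> carrier_mat T T" "Z\<^sup>T * Z \<in> carrier_mat T T"
    "R\<^sup>T \<in> carrier_mat n T"
    using Xp Xm Z R True by (auto intro!: mult_carrier_mat[of _ T n])
  have "R\<^sup>T * (Xp\<^sup>T * P * Xp - Xm\<^sup>T * P * Xm + Z\<^sup>T * Z) * R =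
      R\<^sup>T * (Xp\<^sup>T * P * Xp) * R - R\<^sup>T * (Xm\<^sup>T * P * Xm) * R + R\<^sup>T * (Z\<^sup>T * Z) * R"
    by (rule mult_diff_add_distrib_both[OF car(4,1,2,3) R])
  also have "\<dots> = (Xp * R)\<^sup>T * P * (Xp * R) - (Xm * R)\<^sup>T * P * (Xm * R) + (Z * R)\<^sup>T * (Z * R)"
    unfolding transpose_mult_congruence[OF Xp R True] transpose_mult_congruence[OF Xm R True]
      gram_mult[OF Z R] ..
  also have "(Xm * R)\<^sup>T * P * (Xm * R) = P" using True by (simp add: XR)
  finally show ?thesis using X True by (simp add: lyapunov_solution_def)
qed (use X in \<open>simp add: lyapunov_solution_def\<close>)

text \<open>Stability of \<open>Xp * R\<close> supplies the clause over all \<open>Q\<close> through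
  \<open>lyapunov_solution_unique\<close>.\<close>

lemma condition_ii_iff:
  "condition_ii C D \<gamma> U W X R \<longleftrightarrow> R \<in> carrier_mat T n \<and> Xm * R = 1\<^sub>m n \<and> stable_mat (Xp * R) \<and>
     W * R = 0\<^sub>m d n \<and>
     (\<exists>V\<in>carrier_mat T d. W * V = 1\<^sub>m d \<and> Xm * V = 0\<^sub>m n d \<and> U * V = 0\<^sub>m m d \<and>
       (\<exists>P\<in>carrier_mat n n. (Xp * R)\<^sup>T * P * (Xp * R) - P + (Z * R)\<^sup>T * (Z * R) = 0\<^sub>m n n \<and>
          mat_trace ((Xp * V)\<^sup>T * P * (Xp * V)) < \<gamma>))"
proof (cases "R \<in> carrier_mat T n \<and> Xm * R = 1\<^sub>m n \<and> stable_mat (Xp * R)")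
  case True
  then have R: "R \<in> carrier_mat T n" and XR: "Xm * R = 1\<^sub>m n" and stable: "stable_mat (Xp * R)"
    by auto
  have M: "Xp * R \<in> carrier_mat n n" and H: "(Z * R)\<^sup>T * (Z * R) \<in> carrier_mat n n"
    using Xp Z R by (auto intro!: mult_carrier_mat[of _ n p])
  have app: "(Xm @\<^sub>r U) * V = 0\<^sub>m (n + m) d \<longleftrightarrow> Xm * V = 0\<^sub>m n d \<and> U * V = 0\<^sub>m m d"
    if "V \<in> carrier_mat T d" for V
    using append_rows_mult[OF Xm U that] append_rows_eq_zero_iff[of "Xm * V" n d "U * V" m] Xm U that
    by simp
  have "(\<exists>P. lyapunov_solution C D U X R P \<and> (\<forall>Q. lyapunov_solution C D U X R Q \<longrightarrow> Q = P) \<and> f P)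
    \<longleftrightarrow> (\<exists>P\<in>carrier_mat n n. (Xp * R)\<^sup>T * P * (Xp * R) - P + (Z * R)\<^sup>T * (Z * R) = 0\<^sub>m n n \<and> f P)" for f
    unfolding lyapunov_solution_iff[OF R XR] using lyapunov_solution_unique[OF M stable H] by blast
  then show ?thesis
    unfolding condition_ii_def right_inverse_Xm_iff right_inverse_W_iff
    using True app U W X by auto
qed (auto simp: condition_ii_def right_inverse_Xm_iff)

section \<open>Sufficiency of the conditions\<close>

text \<open>The closed loop and the output matrix are the same for every explaining system, so the
  cost depends on the system through \<open>E\<close> alone. Either the output matrix is zero, or
  \<open>E\<close> is fixed by the data.\<close>

lemma conditions_sufficient:
  assumes cond: "condition_i C D U W X R \<or> condition_ii C D \<gamma> U W X R"
    and S: "S \<in> explaining_systems U W X"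
  shows "h2_suboptimal C D \<gamma> S (U * R)"
proof -
  obtain A B E where S_eq: "S = (A, B, E)" by (cases S)
  note ABE = S[unfolded S_eq]
  from ABE have car: "A \<in> carrier_mat n n" "B \<in> carrier_mat n m" "E \<in> carrier_mat n d"
    by (auto simp: explaining_iff)
  from cond have R: "R \<in> carrier_mat T n" and XR: "Xm * R = 1\<^sub>m n" and stable: "stable_mat (Xp * R)"
    and WR: "W * R = 0\<^sub>m d n" unfolding condition_i_iff condition_ii_iff by auto
  have K: "U * R \<in> carrier_mat m n" using U R by simp
  note cl = closed_loop_eq[OF ABE R XR WR] and out = output_eq[OF R XR]
  have M: "Xp * R \<in> carrier_mat n n" using Xp R by simp
  have cost: "h2_cost C D (A, B, E) (U * R) = mat_trace (E\<^sup>T * P * E)"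
    if "P \<in> carrier_mat n n" "(Xp * R)\<^sup>T * P * (Xp * R) - P + (Z * R)\<^sup>T * (Z * R) = 0\<^sub>m n n" for P
    using h2_cost_eq_lyapunov_trace[OF car C D K] that stable by (simp add: cl out)
  from cond have "h2_cost C D (A, B, E) (U * R) < \<gamma>"
  proof
    assume "condition_i C D U W X R"
    then have ZR: "Z * R = 0\<^sub>m p n" by (simp add: condition_i_iff)
    \<comment> \<open>With zero output matrix, \<open>P = 0\<close> solves the Lyapunov equation, so
      the cost is zero whatever \<open>E\<close> is.\<close>
    have "h2_cost C D (A, B, E) (U * R) = mat_trace (E\<^sup>T * 0\<^sub>m n n * E)"
    proof (rule cost)
      have "(Xp * R)\<^sup>T * 0\<^sub>m n n = 0\<^sub>m n n"
        using M by (intro right_mult_zero_mat[of _ n n]) simp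
      then show "(Xp * R)\<^sup>T * 0\<^sub>m n n * (Xp * R) - 0\<^sub>m n n + (Z * R)\<^sup>T * (Z * R) = 0\<^sub>m n n"
        using left_mult_zero_mat[OF M, of n] by (auto simp: ZR intro!: eq_matI)
    qed simp
    then show ?thesis using car \<gamma> by (simp add: mat_trace_def)
  next
    assume "condition_ii C D \<gamma> U W X R"
    then obtain V P where V: "V \<in> carrier_mat T d" "Xm * V = 0\<^sub>m n d" "U * V = 0\<^sub>m m d" "W * V = 1\<^sub>m d"
      and P: "P \<in> carrier_mat n n" "(Xp * R)\<^sup>T * P * (Xp * R) - P + (Z * R)\<^sup>T * (Z * R) = 0\<^sub>m n n"
      and less: "mat_trace ((Xp * V)\<^sup>T * P * (Xp * V)) < \<gamma>"
      unfolding condition_ii_iff by blast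
    then show ?thesis using cost[OF P] disturbance_matrix_eq[OF ABE V] by simp
  qed
  then show ?thesis using stable by (simp add: h2_suboptimal_def S_eq cl)
qed

section \<open>Necessity of the conditions\<close>

text \<open>Directions of the affine set \<open>explaining_systems U W X\<close>.\<close>

definition unexcited :: "real mat \<Rightarrow> real mat \<Rightarrow> real mat \<Rightarrow> bool" where
  "unexcited A B E \<longleftrightarrow> A \<in> carrier_mat n n \<and> B \<in> carrier_mat n m \<and> E \<in> carrier_mat n d \<and>
     A * Xm + B * U + E * W = 0\<^sub>m n T"

text \<open>This freedom lets a scalar test such as a trace or a single entry detect a whole matrix:
  the multiplier \<open>F\<close> can be adapted to the direction.\<close>

lemma unexcited_mult:
  assumes "unexcited A B E" and F: "F \<in> carrier_mat n n"
  shows "unexcited (F * A) (F * B) (F * E)"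
proof -
  from assms(1) have car: "A \<in> carrier_mat n n" "B \<in> carrier_mat n m" "E \<in> carrier_mat n d"
    and eq: "A * Xm + B * U + E * W = 0\<^sub>m n T" by (auto simp: unexcited_def)
  have prods: "A * Xm \<in> carrier_mat n T" "B * U \<in> carrier_mat n T" "E * W \<in> carrier_mat n T"
    using car Xm U W by auto
  have "F * A * Xm + F * B * U + F * E * W = F * (A * Xm + B * U + E * W)"
    unfolding mult_add_distrib_mat[OF F add_carrier_mat[OF prods(2)] prods(3)]
      mult_add_distrib_mat[OF F prods(1,2)] assoc_mult_mat[OF F car(1) Xm]
      assoc_mult_mat[OF F car(2) U] assoc_mult_mat[OF F car(3) W] ..
  then show ?thesis using car F by (simp add: unexcited_def eq)
qed

lemma explaining_shift:
  assumes "(A, B, E) \<in> explaining_systems U W X" and "unexcited A0 B0 E0"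
  shows "(A + s \<cdot>\<^sub>m A0, B + s \<cdot>\<^sub>m B0, E + s \<cdot>\<^sub>m E0) \<in> explaining_systems U W X"
proof -
  from assms(1) have car: "A \<in> carrier_mat n n" "B \<in> carrier_mat n m" "E \<in> carrier_mat n d"
    and eq: "Xp = A * Xm + B * U + E * W" by (auto simp: explaining_iff)
  from assms(2) have car0: "A0 \<in> carrier_mat n n" "B0 \<in> carrier_mat n m" "E0 \<in> carrier_mat n d"
    and eq0: "A0 * Xm + B0 * U + E0 * W = 0\<^sub>m n T" by (auto simp: unexcited_def)
  have "(A + s \<cdot>\<^sub>m A0) * Xm = A * Xm + s \<cdot>\<^sub>m (A0 * Xm)"
    "(B + s \<cdot>\<^sub>m B0) * U = B * U + s \<cdot>\<^sub>m (B0 * U)"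
    "(E + s \<cdot>\<^sub>m E0) * W = E * W + s \<cdot>\<^sub>m (E0 * W)"
    using car car0 Xm U W
    by (simp_all add: add_mult_distrib_mat[of _ n _ _ _ T] mult_smult_assoc_mat[of _ n _ _ T])
  moreover have "Xp = (A * Xm + s \<cdot>\<^sub>m (A0 * Xm)) + (B * U + s \<cdot>\<^sub>m (B0 * U)) + (E * W + s \<cdot>\<^sub>m (E0 * W))"
  proof (intro eq_matI)
    fix i j
    assume "i < dim_row (A * Xm + s \<cdot>\<^sub>m (A0 * Xm) + (B * U + s \<cdot>\<^sub>m (B0 * U)) + (E * W + s \<cdot>\<^sub>m (E0 * W)))"
      "j < dim_col (A * Xm + s \<cdot>\<^sub>m (A0 * Xm) + (B * U + s \<cdot>\<^sub>m (B0 * U)) + (E * W + s \<cdot>\<^sub>m (E0 * W)))"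
    then have ij: "i < n" "j < T" using car0 W by auto
    have "(A0 * Xm) $$ (i, j) + (B0 * U) $$ (i, j) + (E0 * W) $$ (i, j) = 0"
      using arg_cong[OF eq0, of "\<lambda>M. M $$ (i, j)"] ij car0 Xm U W by (simp del: index_mult_mat(1))
    then have "s * (A0 * Xm) $$ (i, j) + s * (B0 * U) $$ (i, j) + s * (E0 * W) $$ (i, j) = 0"
      by (metis distrib_left mult_zero_right)
    then show "Xp $$ (i, j) =
        (A * Xm + s \<cdot>\<^sub>m (A0 * Xm) + (B * U + s \<cdot>\<^sub>m (B0 * U)) + (E * W + s \<cdot>\<^sub>m (E0 * W))) $$ (i, j)"
      unfolding eq using ij car car0 Xm U W by (simp del: index_mult_mat(1))
  qed (use car car0 Xp Xm U W in auto)
  ultimately show ?thesis using car car0 by (simp add: explaining_iff)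
qed

lemma shifted_closed_loop:
  fixes A B A0 B0 K :: "real mat"
  assumes "A \<in> carrier_mat n n" "B \<in> carrier_mat n m" "A0 \<in> carrier_mat n n" "B0 \<in> carrier_mat n m"
    and "K \<in> carrier_mat m n"
  shows "(A + s \<cdot>\<^sub>m A0) + (B + s \<cdot>\<^sub>m B0) * K = (A + B * K) + s \<cdot>\<^sub>m (A0 + B0 * K)"
proof -
  have "(B + s \<cdot>\<^sub>m B0) * K = B * K + s \<cdot>\<^sub>m (B0 * K)"
    using assms by (simp add: add_mult_distrib_mat[of _ n m _ _ n] mult_smult_assoc_mat[of _ n m _ n])
  then show ?thesis
    using assms by (intro eq_matI) (auto simp: algebra_simps simp del: index_mult_mat(1))
qed

text \<open>
  With \<open>N = A0 + B0 K\<close>, shifting along the direction \<open>N\<^sup>T (A0, B0, E0)\<close> changes the trace of the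
  stable closed loop by a multiple of \<open>tr (N\<^sup>T N)\<close>, while traces of stable matrices are bounded.
\<close>

lemma unexcited_closed_loop_zero:
  assumes K: "K \<in> carrier_mat m n"
    and stab: "\<And>A B E. (A, B, E) \<in> explaining_systems U W X \<Longrightarrow> stable_mat (A + B * K)"
    and un: "unexcited A0 B0 E0"
  shows "A0 + B0 * K = 0\<^sub>m n n"
proof -
  obtain A B E where ABE: "(A, B, E) \<in> explaining_systems U W X" using explained by auto
  then have car: "A \<in> carrier_mat n n" "B \<in> carrier_mat n m" by (auto simp: explaining_iff)
  from un have car0: "A0 \<in> carrier_mat n n" "B0 \<in> carrier_mat n m" by (auto simp: unexcited_def)
  define N where "N = A0 + B0 * K"
  have N: "N \<in> carrier_mat n n" using car0 K by (simp add: N_def)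
  have NT: "N\<^sup>T \<in> carrier_mat n n" using N by simp
  have "\<bar>mat_trace (A + B * K) + s * mat_trace (N\<^sup>T * N)\<bar> \<le> real n" for s
  proof -
    have "N\<^sup>T * A0 + N\<^sup>T * B0 * K = N\<^sup>T * N"
      unfolding N_def[symmetric] using car0 K NT
      by (subst N_def) (simp add: mult_add_distrib_mat[OF NT car0(1)] assoc_mult_mat[OF NT car0(2) K])
    then have "stable_mat ((A + B * K) + s \<cdot>\<^sub>m (N\<^sup>T * N))"
      using stab[OF explaining_shift[OF ABE unexcited_mult[OF un NT], of s]] car car0 NT K
        shifted_closed_loop[of A B "N\<^sup>T * A0" "N\<^sup>T * B0" K s] by simp
    then have "\<bar>mat_trace ((A + B * K) + s \<cdot>\<^sub>m (N\<^sup>T * N))\<bar> \<le> real n"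
      by (rule stable_mat_trace_bound[rotated]) (use car K N in auto)
    moreover have "mat_trace ((A + B * K) + s \<cdot>\<^sub>m (N\<^sup>T * N)) = mat_trace (A + B * K) + s * mat_trace (N\<^sup>T * N)"
      using car K N by (simp add: mat_trace_def sum.distrib sum_distrib_left del: index_mult_mat(1))
    ultimately show ?thesis by simp
  qed
  then have "mat_trace (N\<^sup>T * N) = 0" by (rule bounded_affine_slope_zero)
  then have "N $$ (i, j) = 0" if "i < n" "j < n" for i j
    using entry_square_le_trace_gram[OF N that] by simp
  then show ?thesis using N unfolding N_def[symmetric] by (intro eq_matI) auto
qed

text \<open>Along the line of systems through a fixed one, each entry of the first response is
  affine in \<open>s\<close> with slope the corresponding entry of \<open>(C + D * K) * E0\<close>.
  Its square is at most the cost, hence below \<open>\<gamma>\<close>.\<close>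

lemma unexcited_response_zero:
  assumes K: "K \<in> carrier_mat m n"
    and sub: "\<And>S. S \<in> explaining_systems U W X \<Longrightarrow> h2_suboptimal C D \<gamma> S K"
    and un: "unexcited A0 B0 E0"
  shows "(C + D * K) * E0 = 0\<^sub>m p d"
proof -
  let ?G = "C + D * K"
  have G: "?G \<in> carrier_mat p n" using C D K by simp
  obtain A B E where ABE: "(A, B, E) \<in> explaining_systems U W X" using explained by auto
  then have car: "A \<in> carrier_mat n n" "B \<in> carrier_mat n m" "E \<in> carrier_mat n d"
    by (auto simp: explaining_iff)
  from un have car0: "A0 \<in> carrier_mat n n" "B0 \<in> carrier_mat n m" "E0 \<in> carrier_mat n d"
    by (auto simp: unexcited_def)
  have "(?G * E0) $$ (i, j) = 0" if ij: "i < p" "j < d" for i j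
  proof (rule bounded_affine_slope_zero)
    fix s
    let ?A = "A + s \<cdot>\<^sub>m A0" and ?B = "B + s \<cdot>\<^sub>m B0" and ?E = "E + s \<cdot>\<^sub>m E0"
    have cars: "?A \<in> carrier_mat n n" "?B \<in> carrier_mat n m" "?E \<in> carrier_mat n d"
      using car car0 by auto
    have "h2_suboptimal C D \<gamma> (?A, ?B, ?E) K" by (rule sub[OF explaining_shift[OF ABE un]])
    then have st: "stable_mat (?A + ?B * K)" and cost: "h2_cost C D (?A, ?B, ?E) K < \<gamma>"
      by (auto simp: h2_suboptimal_def)
    have GE: "?G * ?E \<in> carrier_mat p d" using G cars by simp
    have "?G * ?E = ?G * E + s \<cdot>\<^sub>m (?G * E0)"
      using G car car0 by (simp add: mult_add_distrib_mat[of _ p n _ d] mult_smult_distrib[of _ p n _ d])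
    then have entry: "(?G * ?E) $$ (i, j) = (?G * E) $$ (i, j) + s * (?G * E0) $$ (i, j)"
      using C D K car car0 ij by (simp del: index_mult_mat(1))
    have "((?G * ?E) $$ (i, j))\<^sup>2 \<le> mat_trace ((?G * ?E)\<^sup>T * (?G * ?E))"
      by (rule entry_square_le_trace_gram[OF GE ij])
    also have "\<dots> \<le> h2_cost C D (?A, ?B, ?E) K"
      by (rule initial_response_le_h2_cost[OF cars C D K st])
    finally have sq: "((?G * ?E) $$ (i, j))\<^sup>2 \<le> \<gamma>" using cost by simp
    \<comment> \<open>This turns the bound on the square into one on the absolute value without
      square roots.\<close>
    have "\<bar>y\<bar> \<le> y\<^sup>2 + 1" for y :: real
    proof -
      have "0 \<le> (\<bar>y\<bar> - 1)\<^sup>2" by simp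
      then show ?thesis by (simp add: power2_diff)
    qed
    from this[of "(?G * ?E) $$ (i, j)"] sq
    show "\<bar>(?G * E) $$ (i, j) + s * (?G * E0) $$ (i, j)\<bar> \<le> \<gamma> + 1" unfolding entry by linarith
  qed
  then show ?thesis using G car0 by (intro eq_matI) (auto simp del: index_mult_mat(1))
qed

text \<open>A nonzero entry \<open>(i, a)\<close> of \<open>C + D * K\<close> is paired with an
  arbitrary row of \<open>E0\<close> by first multiplying the direction by a matrix unit. The
  vanishing response then makes that row zero.\<close>

lemma unexcited_disturbance_zero:
  assumes K: "K \<in> carrier_mat m n"
    and sub: "\<And>S. S \<in> explaining_systems U W X \<Longrightarrow> h2_suboptimal C D \<gamma> S K"
    and G0: "C + D * K \<noteq> 0\<^sub>m p n"
    and un: "unexcited A0 B0 E0"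
  shows "E0 = 0\<^sub>m n d"
proof -
  let ?G = "C + D * K"
  have G: "?G \<in> carrier_mat p n" using C D K by simp
  from un have E0: "E0 \<in> carrier_mat n d" by (auto simp: unexcited_def)
  have "\<exists>i<p. \<exists>a<n. ?G $$ (i, a) \<noteq> 0"
  proof (rule ccontr)
    assume "\<not> ?thesis"
    then have "?G = 0\<^sub>m p n" using G by (intro eq_matI) (auto simp del: index_add_mat(1))
    then show False using G0 by simp
  qed
  then obtain i a where ia: "i < p" "a < n" "?G $$ (i, a) \<noteq> 0" by blast
  have "E0 $$ (c, j) = 0" if cj: "c < n" "j < d" for c j
  proof -
    \<comment> \<open>Left multiplication by this matrix unit places row \<open>c\<close> of
      \<open>E0\<close> in row \<open>a\<close> and clears all other rows.\<close>
    define F where "F = mat n n (\<lambda>q. if q = (a, c) then 1 else 0 :: real)"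
    have F: "F \<in> carrier_mat n n" by (simp add: F_def)
    have "?G * F * E0 = 0\<^sub>m p d"
      using unexcited_response_zero[OF K sub unexcited_mult[OF un F]] assoc_mult_mat[OF G F E0] by simp
    then have "0 = (?G * F * E0) $$ (i, j)" using ia cj by simp
    also have "\<dots> = (\<Sum>(k, l)\<in>{..<n} \<times> {..<n}. ?G $$ (i, k) * F $$ (k, l) * E0 $$ (l, j))"
      by (rule index_mult_mat_sum3[OF G F E0 ia(1) cj(2)])
    also have "\<dots> = (\<Sum>q\<in>{..<n} \<times> {..<n}. if q = (a, c) then ?G $$ (i, a) * E0 $$ (c, j) else 0)"
      by (intro sum.cong) (auto simp: F_def split: if_splits)
    also have "\<dots> = ?G $$ (i, a) * E0 $$ (c, j)" using ia cj by simp
    finally show ?thesis using ia by simp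
  qed
  then show ?thesis using E0 by (intro eq_matI) auto
qed

text \<open>The annihilators of the stacked data are the unexcited directions. What has been shown
  about them is the solvability criterion, first for \<open>R\<close> and then, if
  \<open>Z * R\<close> is nonzero, for \<open>V\<close>.\<close>

lemma conditions_necessary:
  assumes K: "K \<in> carrier_mat m n"
    and sub: "\<And>S. S \<in> explaining_systems U W X \<Longrightarrow> h2_suboptimal C D \<gamma> S K"
  shows "\<exists>R. (condition_i C D U W X R \<or> condition_ii C D \<gamma> U W X R) \<and> K = U * R"
proof -
  have stab: "stable_mat (A + B * K)" if "(A, B, E) \<in> explaining_systems U W X" for A B E
    using sub[OF that] by (simp add: h2_suboptimal_def)
  obtain A B E where ABE: "(A, B, E) \<in> explaining_systems U W X" using explained by auto
  then have car: "A \<in> carrier_mat n n" "B \<in> carrier_mat n m" "E \<in> carrier_mat n d"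
    by (auto simp: explaining_iff)
  have "\<exists>R\<in>carrier_mat T n. Xm * R = 1\<^sub>m n \<and> U * R = K \<and> W * R = 0\<^sub>m d n"
  proof (rule stacked_mat_solvable[OF Xm U W _ K])
    fix A0 B0 E0 assume car0: "A0 \<in> carrier_mat n n" "B0 \<in> carrier_mat n m" "E0 \<in> carrier_mat n d"
      and "A0 * Xm + B0 * U + E0 * W = 0\<^sub>m n T"
    then have un: "unexcited A0 B0 E0" by (simp add: unexcited_def)
    have "A0 + B0 * K = 0\<^sub>m n n" by (rule unexcited_closed_loop_zero[OF K _ un]) (rule stab)
    then show "A0 * 1\<^sub>m n + B0 * K + E0 * 0\<^sub>m d n = 0\<^sub>m n n" using car0 by simp
  qed auto
  then obtain R where R: "R \<in> carrier_mat T n" and XR: "Xm * R = 1\<^sub>m n" and UR: "U * R = K"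
    and WR: "W * R = 0\<^sub>m d n" by blast
  have cl: "A + B * K = Xp * R" using closed_loop_eq[OF ABE R XR WR] by (simp add: UR)
  have out: "C + D * K = Z * R" using output_eq[OF R XR] by (simp add: UR)
  have stable: "stable_mat (Xp * R)" using stab[OF ABE] by (simp add: cl)
  show ?thesis
  proof (cases "Z * R = 0\<^sub>m p n")
    case True
    then have "condition_i C D U W X R" using R XR WR stable by (simp add: condition_i_iff)
    then show ?thesis using UR by blast
  next
    case False
    \<comment> \<open>Directions have \<open>n\<close> rows, and the second use of
      \<open>stacked_mat_solvable\<close> needs at least one when \<open>d\<close> is positive; a
      nonzero \<open>Z * R\<close> has a column.\<close>
    then have "n > 0" using Z R by (intro gr0I) (auto intro!: eq_matI)
    have "\<exists>V\<in>carrier_mat T d. Xm * V = 0\<^sub>m n d \<and> U * V = 0\<^sub>m m d \<and> W * V = 1\<^sub>m d"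
    proof (rule stacked_mat_solvable[OF Xm U W])
      fix A0 B0 E0 assume car0: "A0 \<in> carrier_mat n n" "B0 \<in> carrier_mat n m" "E0 \<in> carrier_mat n d"
        and "A0 * Xm + B0 * U + E0 * W = 0\<^sub>m n T"
      then have un: "unexcited A0 B0 E0" by (simp add: unexcited_def)
      have "E0 = 0\<^sub>m n d"
        by (rule unexcited_disturbance_zero[OF K sub _ un]) (use False in \<open>auto simp: out\<close>)
      then show "A0 * 0\<^sub>m n d + B0 * 0\<^sub>m m d + E0 * 1\<^sub>m d = 0\<^sub>m n d" using car0 by simp
    qed (use \<open>n > 0\<close> in auto)
    then obtain V where V: "V \<in> carrier_mat T d" "Xm * V = 0\<^sub>m n d" "U * V = 0\<^sub>m m d" "W * V = 1\<^sub>m d"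
      by blast
    have M: "Xp * R \<in> carrier_mat n n" and H: "(Z * R)\<^sup>T * (Z * R) \<in> carrier_mat n n"
      using Xp Z R by (auto intro!: mult_carrier_mat[of _ n p])
    from lyapunov_equation_solvable[OF M stable H] obtain P where P: "P \<in> carrier_mat n n"
      and sol: "(Xp * R)\<^sup>T * P * (Xp * R) - P + (Z * R)\<^sup>T * (Z * R) = 0\<^sub>m n n" by blast
    \<comment> \<open>One explaining system suffices here, since \<open>V\<close> identifies its
      \<open>E\<close> with \<open>Xp * V\<close>.\<close>
    have "h2_cost C D (A, B, E) K = mat_trace (E\<^sup>T * P * E)"
      using h2_cost_eq_lyapunov_trace[OF car C D K _ P] stable sol by (simp add: cl out)
    then have "mat_trace ((Xp * V)\<^sup>T * P * (Xp * V)) < \<gamma>"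
      using sub[OF ABE] disturbance_matrix_eq[OF ABE V] by (simp add: h2_suboptimal_def)
    then have "condition_ii C D \<gamma> U W X R"
      using R XR WR stable V P sol by (auto simp: condition_ii_iff)
    then show ?thesis using UR by blast
  qed
qed

end

theorem theorem13:
  fixes n m d p T :: nat
    and As Bs Es C D U W X :: "real mat"
    and x u w :: "nat \<Rightarrow> real vec"
    and \<gamma> :: real
  assumes "As \<in> carrier_mat n n" "Bs \<in> carrier_mat n m" "Es \<in> carrier_mat n d"
    and "C \<in> carrier_mat p n" "D \<in> carrier_mat p m"
    and "\<And>t. t \<le> T \<Longrightarrow> x t \<in> carrier_vec n"
    and "\<And>t. t < T \<Longrightarrow> u t \<in> carrier_vec m"
    and "\<And>t. t < T \<Longrightarrow> w t \<in> carrier_vec d"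
    and "\<And>t. t < T \<Longrightarrow> x (Suc t) = As *\<^sub>v x t + Bs *\<^sub>v u t + Es *\<^sub>v w t"
    and "U = mat_of_cols m (map u [0..<T])"
    and "W = mat_of_cols d (map w [0..<T])"
    and "X = mat_of_cols n (map x [0..<Suc T])"
    and "\<gamma> > 0"
  shows "(h2_informative C D \<gamma> U W X \<longleftrightarrow>
            (\<exists>R. condition_i C D U W X R) \<or> (\<exists>R. condition_ii C D \<gamma> U W X R)) \<and>
         (\<forall>K \<in> carrier_mat m n.
            (\<forall>S \<in> explaining_systems U W X. h2_suboptimal C D \<gamma> S K) \<longleftrightarrow>
            (\<exists>R. (condition_i C D U W X R \<or> condition_ii C D \<gamma> U W X R) \<and> K = U * R))"
proof -
  have U: "U \<in> carrier_mat m T" and W: "W \<in> carrier_mat d T" and X: "X \<in> carrier_mat n (Suc T)"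
    using assms by (auto simp: mat_of_cols_def)
  have Xm: "past X \<in> carrier_mat n T" using X by (simp add: past_def)
  \<comment> \<open>Read column by column, this is the state recursion; it puts the true system
    among the explaining ones and so discharges \<open>explained\<close>.\<close>
  have "future X = As * past X + Bs * U + Es * W"
  proof (intro eq_matI)
    fix i t assume "i < dim_row (As * past X + Bs * U + Es * W)" "t < dim_col (As * past X + Bs * U + Es * W)"
    then have it: "i < n" "t < T" using assms(3) W by auto
    have entry: "(map f [0..<k]) ! s = f s" if "s < k" for f :: "nat \<Rightarrow> real vec" and s k
      using that by simp
    have x: "x t \<in> carrier_vec n" "x (Suc t) \<in> carrier_vec n" and u: "u t \<in> carrier_vec m"
      and w: "w t \<in> carrier_vec d" using it assms(6-8) by auto
    have cols: "col (past X) t = x t" "col U t = u t" "col W t = w t"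
      using it x u w X U W unfolding past_def assms(10-12)
      by (auto intro!: eq_vecI simp: mat_of_cols_def entry simp del: upt_Suc)
    \<comment> \<open>The index \<open>Suc t\<close> stays within the \<open>Suc T\<close> recorded
      states because \<open>t < T\<close>.\<close>
    have "future X $$ (i, t) = x (Suc t) $ i"
      using it X unfolding future_def assms(12)
      by (simp add: mat_of_cols_def entry del: upt_Suc)
    also have "\<dots> = row As i \<bullet> x t + row Bs i \<bullet> u t + row Es i \<bullet> w t"
      using assms(1-3) it u w x by (simp add: assms(9)[OF it(2)])
    also have "\<dots> = (As * past X + Bs * U + Es * W) $$ (i, t)"
      using it assms(1-3) Xm U W by (simp add: cols)
    finally show "future X $$ (i, t) = (As * past X + Bs * U + Es * W) $$ (i, t)" .
  qed (use assms(3) X W in \<open>auto simp: future_def\<close>)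
  then have "(As, Bs, Es) \<in> explaining_systems U W X"
    using assms(1-3) U W X by (simp add: explaining_systems_def)
  then interpret input_disturbance_state_data n m d p T C D U W X \<gamma>
    using assms(4,5,13) U W X by unfold_locales auto
  have feedback: "(\<forall>S \<in> explaining_systems U W X. h2_suboptimal C D \<gamma> S K) \<longleftrightarrow>
      (\<exists>R. (condition_i C D U W X R \<or> condition_ii C D \<gamma> U W X R) \<and> K = U * R)"
    if "K \<in> carrier_mat m n" for K
    using conditions_necessary[OF that] conditions_sufficient by blast
  \<comment> \<open>Informativity quantifies over gains of fixed dimensions, so a witness
    \<open>R\<close> must be shown to produce such a gain.\<close>
  have gain: "U * R \<in> carrier_mat m n" if "condition_i C D U W X R \<or> condition_ii C D \<gamma> U W X R" for R
    using that U unfolding condition_i_iff condition_ii_iff by auto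
  have "h2_informative C D \<gamma> U W X \<longleftrightarrow>
      (\<exists>R. condition_i C D U W X R \<or> condition_ii C D \<gamma> U W X R)"
    using feedback gain U X unfolding h2_informative_def by (metis carrier_matD)
  then show ?thesis using feedback by blast
qed

end
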